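(* Let $K$ be a field, let $\mathcal{I} \subset \mathbb{N}^2$ be an interval, and let $\mathcal{P}_{\mathcal{I}}$ be the collection of all cells of $\mathbb{N}^2$ contained in $\mathcal{I}$. Let $\mathcal{P}$ be a convex polyomino which is a subpolyomino of $\mathcal{P}_{\mathcal{I}}$ (i.e. every cell of $\mathcal{P}$ belongs to $\mathcal{P}_{\mathcal{I}}$). Let $\mathcal{P}^c = \mathcal{P}_{\mathcal{I}} \setminus \mathcal{P}$ be the collection of those cells of $\mathcal{P}_{\mathcal{I}}$ which do not belong to $\mathcal{P}$, and suppose that $\mathcal{P}^c$ is a polyomino. Then the polyomino ideal $I_{\mathcal{P}^c}$ is a prime ideal of the polynomial ring $S = K[x_v : v \in V(\mathcal{P}^c)]$.
   Context: $\mathbb{N}$ is the set of nonnegative integers and $\mathbb{N}^2=\{(i,j): i,j\in\mathbb{N}\}$, with the componentwise partial order $\leq$. For $a=(i,j)$ and $b=(k,\ell)$ in $\mathbb{N}^2$ write $a<b$ if $i<k$ and $j<\ell$ (both strict). When $a<b$, the interval $[a,b]$ is $\{c\in\mathbb{N}^2 : a\leq c\leq b\}$; its diagonal corners are $a,b$ and its anti-diagonal corners are $(i,\ell)$ and $(k,j)$. A cell with lower left corner $a\in\mathbb{N}^2$ is the interval $C=[a,a+(1,1)]$. Its vertices are $a,\ a+(1,0),\ a+(0,1),\ a+(1,1)$, and its edges are $\{a,a+(1,0)\}$, $\{a,a+(0,1)\}$, $\{a+(1,0),a+(1,1)\}$, $\{a+(0,1),a+(1,1)\}$. For a finite collection $\mathcal{P}$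 of cells, $V(\mathcal{P})$ is the set of all vertices of its cells. A finite collection $\mathcal{P}$ of cells is a polyomino if any two cells $C,D$ of $\mathcal{P}$ are connected in $\mathcal{P}$, i.e. there is a sequence $C=C_1,\ldots,C_m=D$ of cells of $\mathcal{P}$ such that $C_i\cap C_{i+1}$ is an edge of $C_i$ for $i=1,\ldots,m-1$. For an interval $[a,b]$, $\mathcal{P}_{[a,b]}$ denotes the polyomino consisting of all cells contained in $[a,b]$. $\mathcal{P}$ is row convex if, whenever two cells with lower left corners $(i,j)$ and $(k,j)$, $i\leq k$, belong to $\mathcal{P}$, all cells with lower left corner $(r,j)$, $i\leq r\leq k$, belong to $\mathcal{P}$. Column convex is defined analogously with the roles of the coordinates exchanged. $\mathcal{P}$ is convex if it is both row convex and column convex. For a finite collection $\mathcal{P}$ of cells and a field $K$, let $S$ be the polynomial ring over $K$ in the variables $x_v$, $v\in V(\mathcal{P})$. An interval $[a,b]$ is an interval of $\mathcal{P}$ if $\mathcal{P}_{[a,b]}\subset\mathcal{P}$. For each interval $[a,b]$ of $\mathcal{P}$, with anti-diagonal corners $c,d$, the binomial $f_{a,b}=x_ax_b-x_cx_d$ is called an inner $2$-minor of $\mathcal{P}$. $I_{\mathcal{P}}\subset S$ is the ideal generated by all inner $2$-minors of $\mathcal{P}$; when $\mathcal{P}$ is a polyomino it is called the polyomino ideal of $\mathcal{P}$. *)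

theory Defs
  imports
    "HOL-Algebra.Ideal"
    "HOL-Library.Poly_Mapping"
    "HOL-Library.Product_Order"
    "HOL-Library.Product_Plus"
begin

text \<open>
  Lattice points are pairs of natural numbers with the componentwise order of
  \<^theory>\<open>HOL-Library.Product_Order\<close>, so \<open>{a..b}\<close> is the interval with diagonal corners
  \<open>a\<close> and \<open>b\<close>. The class relation \<open><\<close> on pairs is the strict part of \<open>\<le>\<close>, whereas an interval
  with diagonal corners \<open>a\<close>, \<open>b\<close> requires both coordinates to increase strictly; that relation
  is \<open>strictly_below\<close>.
\<close>

type_synonym point = "nat \<times> nat"
type_synonym cell = "point set"

definition strictly_below :: "point \<Rightarrow> point \<Rightarrow> bool" where
  "strictly_below a b \<longleftrightarrow> fst a < fst b \<and> snd a < snd b"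

definition cell_at :: "point \<Rightarrow> cell" where
  "cell_at a = {a..a + (1, 1)}"

lemma cell_at_eq: "cell_at a = {a, a + (1, 0), a + (0, 1), a + (1, 1)}"
  by (cases a) (auto simp: cell_at_def less_eq_prod_def prod_eq_iff)

lemma cell_at_inject [simp]: "cell_at a = cell_at b \<longleftrightarrow> a = b"
  by (auto simp: cell_at_def Icc_eq_Icc less_eq_prod_def)

definition is_edge_of :: "point set \<Rightarrow> cell \<Rightarrow> bool" where
  "is_edge_of e C \<longleftrightarrow> (\<exists>a. C = cell_at a \<and>
     e \<in> {{a, a + (1, 0)}, {a, a + (0, 1)}, {a + (1, 0), a + (1, 1)}, {a + (0, 1), a + (1, 1)}})"

text \<open>A cell is the set of its four vertices (\<open>cell_at_eq\<close>), so a union of cells is the set of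
  all their vertices.\<close>

definition cell_vertices :: "cell set \<Rightarrow> point set" where
  "cell_vertices P = \<Union>P"

definition connected_cells :: "cell set \<Rightarrow> cell \<Rightarrow> cell \<Rightarrow> bool" where
  "connected_cells P C D \<longleftrightarrow> (\<exists>Cs. Cs \<noteq> [] \<and> set Cs \<subseteq> P \<and> hd Cs = C \<and> last Cs = D \<and>
     (\<forall>i. Suc i < length Cs \<longrightarrow> is_edge_of (Cs ! i \<inter> Cs ! Suc i) (Cs ! i)))"

definition polyomino :: "cell set \<Rightarrow> bool" where
  "polyomino P \<longleftrightarrow> finite P \<and> P \<subseteq> range cell_at \<and> (\<forall>C\<in>P. \<forall>D\<in>P. connected_cells P C D)"

definition cells_in :: "point set \<Rightarrow> cell set" where
  "cells_in I = {C \<in> range cell_at. C \<subseteq> I}"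

definition row_convex :: "cell set \<Rightarrow> bool" where
  "row_convex P \<longleftrightarrow> (\<forall>i j k. i \<le> k \<and> cell_at (i, j) \<in> P \<and> cell_at (k, j) \<in> P \<longrightarrow>
     (\<forall>r. i \<le> r \<and> r \<le> k \<longrightarrow> cell_at (r, j) \<in> P))"

definition column_convex :: "cell set \<Rightarrow> bool" where
  "column_convex P \<longleftrightarrow> (\<forall>i j l. j \<le> l \<and> cell_at (i, j) \<in> P \<and> cell_at (i, l) \<in> P \<longrightarrow>
     (\<forall>s. j \<le> s \<and> s \<le> l \<longrightarrow> cell_at (i, s) \<in> P))"

definition convex_cells :: "cell set \<Rightarrow> bool" where
  "convex_cells P \<longleftrightarrow> row_convex P \<and> column_convex P"


text \<open>
  Polynomials in variables \<open>x\<^sub>v\<close>, \<open>v :: 'v\<close>, are finitely supported maps from monomials (finitely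
  supported exponent maps) to coefficients; the type carries the convolution product.
  The polynomial ring in the variables \<open>x\<^sub>v\<close> with \<open>v \<in> V\<close> is the subring of those polynomials
  in whose monomials only variables from \<open>V\<close> occur.
\<close>

type_synonym ('v, 'k) polynomial = "('v \<Rightarrow>\<^sub>0 nat) \<Rightarrow>\<^sub>0 'k"

definition poly_var :: "'v \<Rightarrow> ('v, 'k::comm_ring_1) polynomial" where
  "poly_var v = Poly_Mapping.single (Poly_Mapping.single v 1) 1"

definition mpoly_ring :: "'v set \<Rightarrow> ('v, 'k::comm_ring_1) polynomial ring" where
  "mpoly_ring V = \<lparr>carrier = {p. \<forall>m \<in> Poly_Mapping.keys p. Poly_Mapping.keys m \<subseteq> V},
     mult = (*), one = 1, zero = 0, add = (+)\<rparr>"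

lemma cring_mpoly_ring: "cring (mpoly_ring V :: ('v, 'k::comm_ring_1) polynomial ring)"
proof (rule cringI)
  let ?R = "mpoly_ring V :: ('v, 'k) polynomial ring"
  have add: "p + q \<in> carrier ?R" if "p \<in> carrier ?R" "q \<in> carrier ?R" for p q
    using that Poly_Mapping.keys_add[of p q] unfolding mpoly_ring_def by fastforce
  have neg: "- p \<in> carrier ?R" if "p \<in> carrier ?R" for p
    using that by (simp add: mpoly_ring_def)
  have mult: "p * q \<in> carrier ?R" if "p \<in> carrier ?R" "q \<in> carrier ?R" for p q
  proof -
    have "Poly_Mapping.keys m \<subseteq> V" if m: "m \<in> Poly_Mapping.keys (p * q)" for m
    proof -
      from subsetD[OF keys_mult m] obtain a b
        where "m = a + b" "a \<in> Poly_Mapping.keys p" "b \<in> Poly_Mapping.keys q" by blast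
      with \<open>p \<in> carrier ?R\<close> \<open>q \<in> carrier ?R\<close> Poly_Mapping.keys_add[of a b]
      show ?thesis unfolding mpoly_ring_def by fastforce
    qed
    then show ?thesis by (simp add: mpoly_ring_def)
  qed
  have ops: "\<one>\<^bsub>?R\<^esub> = 1" "\<zero>\<^bsub>?R\<^esub> = 0" "p \<otimes>\<^bsub>?R\<^esub> q = p * q" "p \<oplus>\<^bsub>?R\<^esub> q = p + q" for p q
    by (simp_all add: mpoly_ring_def)
  have "0 \<in> carrier ?R" "1 \<in> carrier ?R"
    by (simp_all add: mpoly_ring_def)
  note closed = this add neg mult
  show "abelian_group ?R"
  proof (rule abelian_groupI)
    fix p assume "p \<in> carrier ?R"
    then show "\<exists>q\<in>carrier ?R. q \<oplus>\<^bsub>?R\<^esub> p = \<zero>\<^bsub>?R\<^esub>"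
      using neg[of p] by (intro bexI[of _ "- p"]) (simp_all add: ops)
  qed (simp_all add: ops closed add.assoc add.commute)
  show "Group.comm_monoid ?R"
    by (rule comm_monoidI) (simp_all add: ops closed mult.assoc mult.commute)
  show "(p \<oplus>\<^bsub>?R\<^esub> q) \<otimes>\<^bsub>?R\<^esub> r = p \<otimes>\<^bsub>?R\<^esub> r \<oplus>\<^bsub>?R\<^esub> q \<otimes>\<^bsub>?R\<^esub> r" for p q r
    by (simp add: ops distrib_right)
qed

definition interval_of :: "cell set \<Rightarrow> point \<Rightarrow> point \<Rightarrow> bool" where
  "interval_of P a b \<longleftrightarrow> strictly_below a b \<and> cells_in {a..b} \<subseteq> P"

definition inner_minor :: "point \<Rightarrow> point \<Rightarrow> (point, 'k::comm_ring_1) polynomial" where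
  "inner_minor a b = poly_var a * poly_var b - poly_var (fst a, snd b) * poly_var (fst b, snd a)"

definition inner_minors :: "cell set \<Rightarrow> (point, 'k::comm_ring_1) polynomial set" where
  "inner_minors P = {inner_minor a b | a b. interval_of P a b}"

definition polyomino_ideal :: "cell set \<Rightarrow> (point, 'k::comm_ring_1) polynomial set" where
  "polyomino_ideal P = genideal (mpoly_ring (cell_vertices P)) (inner_minors P)"

lemma inner_minors_in_carrier:
  "inner_minors P \<subseteq> carrier (mpoly_ring (cell_vertices P) :: (point, 'k::comm_ring_1) polynomial ring)"
proof
  let ?R = "mpoly_ring (cell_vertices P) :: (point, 'k) polynomial ring"
  interpret R: cring ?R by (rule cring_mpoly_ring)
  have var: "poly_var v \<in> carrier ?R" if "v \<in> cell_vertices P" for v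
    using that by (simp add: mpoly_ring_def poly_var_def)
  have mult: "p * q \<in> carrier ?R" if "p \<in> carrier ?R" "q \<in> carrier ?R" for p q
    using R.m_closed[OF that] by (simp add: mpoly_ring_def)
  have diff: "p - q \<in> carrier ?R" if "p \<in> carrier ?R" "q \<in> carrier ?R" for p q
  proof -
    have "- q \<in> carrier ?R" using that by (simp add: mpoly_ring_def)
    from R.add.m_closed[OF that(1) this] show ?thesis by (simp add: mpoly_ring_def)
  qed
  fix f :: "(point, 'k) polynomial" assume "f \<in> inner_minors P"
  then obtain a b where f: "f = inner_minor a b" and ab: "strictly_below a b" "cells_in {a..b} \<subseteq> P"
    by (auto simp: inner_minors_def interval_of_def)
  obtain i j k l where [simp]: "a = (i, j)" "b = (k, l)" by fastforce
  have lt: "i < k" "j < l" using ab(1) by (simp_all add: strictly_below_def)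
  have in_V: "v \<in> cell_vertices P" if "v \<in> cell_at c" "a \<le> c" "c + (1, 1) \<le> b" for v c
  proof -
    have "cell_at c \<in> cells_in {a..b}"
      using that(2,3) by (auto simp: cells_in_def cell_at_def intro: order_trans)
    then show ?thesis using that(1) ab(2) by (auto simp: cell_vertices_def)
  qed
  have "(i, j) \<in> cell_vertices P" "(k, l) \<in> cell_vertices P"
    "(i, l) \<in> cell_vertices P" "(k, j) \<in> cell_vertices P"
  proof -
    show "(i, j) \<in> cell_vertices P"
      by (rule in_V[of _ "(i, j)"]) (use lt in \<open>auto simp: cell_at_eq\<close>)
    show "(k, l) \<in> cell_vertices P"
      by (rule in_V[of _ "(k - 1, l - 1)"]) (use lt in \<open>auto simp: cell_at_eq\<close>)
    show "(i, l) \<in> cell_vertices P"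
      by (rule in_V[of _ "(i, l - 1)"]) (use lt in \<open>auto simp: cell_at_eq\<close>)
    show "(k, j) \<in> cell_vertices P"
      by (rule in_V[of _ "(k - 1, j)"]) (use lt in \<open>auto simp: cell_at_eq\<close>)
  qed
  then show "f \<in> carrier ?R"
    unfolding f inner_minor_def by (intro diff mult var) simp_all
qed

end

theory Submission
  imports Defs "HOL-Library.Multiset" "HOL-Library.Countable"
begin

text \<open>
  The ideal is shown to be the kernel of a monomial map into a polynomial ring, hence prime. Besides
  a variable for each row and each column, the target has one variable for every cell of the convex
  polyomino \<open>P\<close>, which occurs in the image of \<open>x\<^sub>v\<close> iff \<open>v\<close> lies weakly below and to the left of that
  cell. An interval contributes an inner minor precisely if it avoids \<open>P\<close>, and these are exactly the
  intervals whose minor leaves the cell variables balanced.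

  What has to be proved is that two monomials with the same image are connected by inner minors.
  By induction on the degree it suffices to move them until they share a variable. If some row or
  column is cut by \<open>P\<close>, both monomials have equally many variables on each side of the cut, and the
  convexity of \<open>P\<close> leaves enough free rectangles to make two variables on the same side agree.
  Otherwise all variables lie in the four corner regions around \<open>P\<close>, and the count for a single
  cell of \<open>P\<close> suffices.
\<close>

section \<open>Swaps avoiding a set of cells\<close>

text \<open>A cell is represented by its lower left corner. The corners of a rectangle may come in any
  order, so that swaps are symmetric; degenerate rectangles give trivial swaps. Coordinates are
  integers in order to have reflections.\<close>

definition rect_free :: "(int \<times> int) set \<Rightarrow> int \<Rightarrow> int \<Rightarrow> int \<Rightarrow> int \<Rightarrow> bool" where
  "rect_free P i j k l \<longleftrightarrow>
     (\<forall>p\<in>P. \<not> (min i k \<le> fst p \<and> fst p < max i k \<and> min j l \<le> snd p \<and> snd p < max j l))"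

definition swap_step :: "(int \<times> int) set \<Rightarrow> (int \<times> int) multiset \<Rightarrow> (int \<times> int) multiset \<Rightarrow> bool" where
  "swap_step P A B \<longleftrightarrow> (\<exists>i j k l M. A = {#(i, j), (k, l)#} + M \<and> B = {#(i, l), (k, j)#} + M \<and>
     rect_free P i j k l)"

abbreviation swaps :: "(int \<times> int) set \<Rightarrow> (int \<times> int) multiset \<Rightarrow> (int \<times> int) multiset \<Rightarrow> bool" where
  "swaps P \<equiv> (swap_step P)\<^sup>*\<^sup>*"

text \<open>The conditions compare the degrees of two monomial images in the column, row and cell
  variables of the toric map.\<close>

definition balanced :: "(int \<times> int) set \<Rightarrow> (int \<times> int) multiset \<Rightarrow> (int \<times> int) multiset \<Rightarrow> bool" where
  "balanced P A B \<longleftrightarrow> image_mset fst A = image_mset fst B \<and> image_mset snd A = image_mset snd B \<and>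
     (\<forall>p\<in>P. size {#v \<in># A. fst v \<le> fst p \<and> snd v \<le> snd p#}
          = size {#v \<in># B. fst v \<le> fst p \<and> snd v \<le> snd p#})"

text \<open>Reaching a common variable is what one induction step on the degree requires, since
  \<open>balanced\<close> survives cancelling it.\<close>

definition swap_meet :: "(int \<times> int) set \<Rightarrow> (int \<times> int) multiset \<Rightarrow> (int \<times> int) multiset \<Rightarrow> bool" where
  "swap_meet P A B \<longleftrightarrow> (\<exists>A' B' v. swaps P A A' \<and> swaps P B B' \<and> v \<in># A' \<and> v \<in># B')"

lemma rect_free_swap: "rect_free P i l k j \<longleftrightarrow> rect_free P i j k l"
  by (simp add: rect_free_def min.commute max.commute)

lemma swap_step_sym: "swap_step P A B \<Longrightarrow> swap_step P B A"
  unfolding swap_step_def using rect_free_swap by blast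

lemma swaps_sym: "swaps P A B \<Longrightarrow> swaps P B A"
  by (metis sympD sympI symp_rtranclp swap_step_sym)

lemma swaps_add:
  assumes "swaps P A B"
  shows "swaps P (add_mset v A) (add_mset v B)"
  using assms
proof induction
  case (step B C)
  then obtain i j k l M where "B = {#(i, j), (k, l)#} + M" "C = {#(i, l), (k, j)#} + M"
    "rect_free P i j k l"
    by (auto simp: swap_step_def)
  then have "swap_step P (add_mset v B) (add_mset v C)"
    unfolding swap_step_def
    by (intro exI[of _ i] exI[of _ j] exI[of _ k] exI[of _ l] exI[of _ "add_mset v M"]) simp
  with step.IH show ?case by simp
qed simp

lemma size_filter_split:
  assumes "\<And>x. Q x \<longleftrightarrow> R x \<or> S x" "\<And>x. \<not> (R x \<and> S x)"
  shows "size {#x \<in># A. Q x#} = size {#x \<in># A. R x#} + size {#x \<in># A. S x#}"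
  by (induction A) (use assms in auto)

lemma balanced_refl: "balanced P A A"
  by (simp add: balanced_def)

lemma balanced_sym: "balanced P A B \<Longrightarrow> balanced P B A"
  by (simp add: balanced_def)

lemma balanced_trans: "balanced P A B \<Longrightarrow> balanced P B C \<Longrightarrow> balanced P A C"
  by (simp add: balanced_def)

text \<open>Rows and columns are only paired anew. For a cell \<open>p\<close>, the quadrant
  indicators of the two old and of the two new corners can have different sums only if
  \<open>p\<close> lies in the rectangle, and \<open>rect_free\<close> excludes that.\<close>

lemma swap_step_balanced:
  assumes "swap_step P A B"
  shows "balanced P A B"
proof -
  obtain i j k l M where AB: "A = {#(i, j), (k, l)#} + M" "B = {#(i, l), (k, j)#} + M"
    and free: "rect_free P i j k l"
    using assms by (auto simp: swap_step_def)
  have "size {#v \<in># A. fst v \<le> fst p \<and> snd v \<le> snd p#}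
      = size {#v \<in># B. fst v \<le> fst p \<and> snd v \<le> snd p#}" if "p \<in> P" for p
    using free that unfolding rect_free_def AB by (fastforce simp: min_def max_def split: if_splits)
  then show ?thesis
    by (simp add: balanced_def AB add_mset_commute)
qed

lemma swaps_balanced: "swaps P A B \<Longrightarrow> balanced P A B"
  by (induction rule: rtranclp_induct)
    (auto intro: balanced_refl balanced_trans swap_step_balanced)

lemma balanced_add_iff: "balanced P (add_mset v A) (add_mset v B) \<longleftrightarrow> balanced P A B"
  by (auto simp: balanced_def)

lemma balanced_size: "balanced P A B \<Longrightarrow> size A = size B"
  by (metis balanced_def size_image_mset)

lemma balanced_quadrant:
  assumes "balanced P A B" "(x, y) \<in> P"
  shows "size {#v \<in># A. fst v \<le> x \<and> snd v \<le> y#} = size {#v \<in># B. fst v \<le> x \<and> snd v \<le> y#}"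
  using assms by (force simp: balanced_def)

lemma balanced_col_ex:
  assumes "balanced P A B" "(i, j) \<in># A"
  shows "\<exists>l. (i, l) \<in># B"
proof -
  have "i \<in># image_mset fst A" using assms(2) by force
  also have "image_mset fst A = image_mset fst B" using assms(1) by (simp add: balanced_def)
  finally show ?thesis by auto
qed

lemma balanced_row_ex:
  assumes "balanced P A B" "(i, j) \<in># A"
  shows "\<exists>k. (k, j) \<in># B"
proof -
  have "j \<in># image_mset snd A" using assms(2) by force
  also have "image_mset snd A = image_mset snd B" using assms(1) by (simp add: balanced_def)
  finally show ?thesis by auto
qed

lemma balanced_size_fst:
  assumes "balanced P A B"
  shows "size {#v \<in># A. Q (fst v)#} = size {#v \<in># B. Q (fst v)#}"
proof -
  have "size {#v \<in># C. Q (fst v)#} = size {#x \<in># image_mset fst C. Q x#}" for C :: "(int \<times> int) multiset"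
    by (simp add: filter_mset_image_mset)
  with assms show ?thesis by (simp add: balanced_def)
qed

lemma balanced_size_snd:
  assumes "balanced P A B"
  shows "size {#v \<in># A. Q (snd v)#} = size {#v \<in># B. Q (snd v)#}"
proof -
  have "size {#v \<in># C. Q (snd v)#} = size {#x \<in># image_mset snd C. Q x#}" for C :: "(int \<times> int) multiset"
    by (simp add: filter_mset_image_mset)
  with assms show ?thesis by (simp add: balanced_def)
qed

lemma swap_meet_sym: "swap_meet P A B \<Longrightarrow> swap_meet P B A"
  unfolding swap_meet_def by blast

lemma swap_meet_common: "\<lbrakk>v \<in># A; v \<in># B\<rbrakk> \<Longrightarrow> swap_meet P A B"
  unfolding swap_meet_def by blast

lemma swap_meet_swaps: "\<lbrakk>swaps P A A'; swaps P B B'; swap_meet P A' B'\<rbrakk> \<Longrightarrow> swap_meet P A B"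
  unfolding swap_meet_def by (meson rtranclp_trans)

lemma swap_ex:
  assumes "(i, j) \<in># A" "(k, l) \<in># A" "rect_free P i j k l"
  shows "\<exists>A'. swaps P A A' \<and> (i, l) \<in># A' \<and> (k, j) \<in># A'"
\<comment> \<open>If the points coincide, both memberships may refer to one occurrence; the swap is
  then trivial.\<close>
proof (cases "(i, j) = (k, l)")
  case True
  with assms show ?thesis by blast
next
  case False
  obtain A1 where A1: "A = add_mset (i, j) A1" using assms(1) by (rule mset_add)
  with assms(2) False have "(k, l) \<in># A1" by auto
  then obtain M where "A1 = add_mset (k, l) M" by (rule mset_add)
  with A1 have "A = {#(i, j), (k, l)#} + M" by simp
  with assms(3) have "swap_step P A ({#(i, l), (k, j)#} + M)"
    unfolding swap_step_def by blast
  then show ?thesis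
    by (intro exI[of _ "{#(i, l), (k, j)#} + M"]) auto
qed

lemma swap_meet_by_swap:
  assumes "(i, j) \<in># A" "(k, l) \<in># A" "rect_free P i j k l" "(k, j) \<in># B"
  shows "swap_meet P A B"
  using swap_ex[OF assms(1-3)] assms(4) unfolding swap_meet_def by blast

section \<open>Symmetries\<close>

text \<open>Reflecting points by \<open>x \<mapsto> - x\<close> sends the cell with left edge \<open>x\<close> to the one with left edge
  \<open>- x - 1\<close>.\<close>

definition xflip :: "(int \<times> int) set \<Rightarrow> (int \<times> int) set" where
  "xflip P = {(x, y). (- x - 1, y) \<in> P}"

definition diag_flip :: "(int \<times> int) set \<Rightarrow> (int \<times> int) set" where
  "diag_flip P = {(x, y). (y, x) \<in> P}"

abbreviation xneg :: "int \<times> int \<Rightarrow> int \<times> int" where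
  "xneg \<equiv> map_prod uminus id"

text \<open>Defined by conjugation, so that its transport results come from composing those of
  \<open>xflip\<close> and \<open>diag_flip\<close>.\<close>

definition yflip :: "(int \<times> int) set \<Rightarrow> (int \<times> int) set" where
  "yflip P = diag_flip (xflip (diag_flip P))"

abbreviation yneg :: "int \<times> int \<Rightarrow> int \<times> int" where
  "yneg \<equiv> map_prod id uminus"

lemma mem_xflip [simp]: "(x, y) \<in> xflip P \<longleftrightarrow> (- x - 1, y) \<in> P"
  by (simp add: xflip_def)

lemma mem_diag_flip [simp]: "(x, y) \<in> diag_flip P \<longleftrightarrow> (y, x) \<in> P"
  by (simp add: diag_flip_def)

lemma mem_yflip [simp]: "(x, y) \<in> yflip P \<longleftrightarrow> (x, - y - 1) \<in> P"
  by (simp add: yflip_def)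

lemma image_yneg:
  "image_mset yneg A = image_mset prod.swap (image_mset xneg (image_mset prod.swap A))"
  by (induction A) (simp_all add: map_prod_def case_prod_beta)

lemma xflip_eq_empty [simp]: "xflip P = {} \<longleftrightarrow> P = {}"
proof
  assume "xflip P = {}"
  then have "(x, y) \<notin> P" for x y using mem_xflip[of "- x - 1" y P] by simp
  then show "P = {}" by auto
qed (simp add: xflip_def)

lemma diag_flip_eq_empty [simp]: "diag_flip P = {} \<longleftrightarrow> P = {}"
  by (auto simp: diag_flip_def)

lemma yflip_eq_empty [simp]: "yflip P = {} \<longleftrightarrow> P = {}"
  by (simp add: yflip_def)

lemma xflip_xflip [simp]: "xflip (xflip P) = P"
  by (auto simp: xflip_def)

lemma diag_flip_diag_flip [simp]: "diag_flip (diag_flip P) = P"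
  by (auto simp: diag_flip_def)

lemma xneg_xneg [simp]: "image_mset xneg (image_mset xneg A) = A"
  by (simp add: multiset.map_comp o_def map_prod_def case_prod_beta)

lemma swap_swap_mset [simp]: "image_mset prod.swap (image_mset prod.swap A) = A"
  by (simp add: multiset.map_comp o_def)

lemma swaps_map:
  assumes step: "\<And>A B. swap_step P A B \<Longrightarrow> swap_step Q (image_mset f A) (image_mset f B)"
    and "swaps P A B"
  shows "swaps Q (image_mset f A) (image_mset f B)"
  using assms(2)
proof induction
  case (step B C)
  then show ?case using assms(1)[OF step.hyps(2)] by simp
qed simp

lemma swap_step_xneg:
  assumes "swap_step P A B"
  shows "swap_step (xflip P) (image_mset xneg A) (image_mset xneg B)"
proof -
  obtain i j k l M where AB: "A = {#(i, j), (k, l)#} + M" "B = {#(i, l), (k, j)#} + M"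
    and free: "rect_free P i j k l"
    using assms by (auto simp: swap_step_def)
  from free have "rect_free (xflip P) (- i) j (- k) l"
    unfolding rect_free_def by (force simp: xflip_def min_def max_def split: if_splits)
  then show ?thesis unfolding swap_step_def AB
    by (intro exI[of _ "- i"] exI[of _ j] exI[of _ "- k"] exI[of _ l] exI[of _ "image_mset xneg M"]) simp
qed

lemma swap_step_diag_flip:
  assumes "swap_step P A B"
  shows "swap_step (diag_flip P) (image_mset prod.swap A) (image_mset prod.swap B)"
proof -
  obtain i j k l M where AB: "A = {#(i, j), (k, l)#} + M" "B = {#(i, l), (k, j)#} + M"
    and free: "rect_free P i j k l"
    using assms by (auto simp: swap_step_def)
  from free have "rect_free (diag_flip P) j i l k"
    unfolding rect_free_def diag_flip_def by fastforce
  then show ?thesis unfolding swap_step_def AB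
    by (intro exI[of _ j] exI[of _ i] exI[of _ l] exI[of _ k] exI[of _ "image_mset prod.swap M"])
      (simp add: add_mset_commute)
qed

text \<open>The reflection is an involution, so swaps found in the mirror image reflect back to
  swaps avoiding \<open>P\<close>. This lets later proofs treat a single orientation.\<close>

lemma swap_meet_xflip:
  assumes "swap_meet (xflip P) (image_mset xneg A) (image_mset xneg B)"
  shows "swap_meet P A B"
proof -
  obtain A' B' v where "swaps (xflip P) (image_mset xneg A) A'" "swaps (xflip P) (image_mset xneg B) B'"
    "v \<in># A'" "v \<in># B'"
    using assms by (auto simp: swap_meet_def)
  with swaps_map[of "xflip P" P xneg, OF swap_step_xneg[of "xflip P", simplified]]
  have "swaps P A (image_mset xneg A')" "swaps P B (image_mset xneg B')"
    "xneg v \<in># image_mset xneg A'" "xneg v \<in># image_mset xneg B'"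
    by (force simp del: multiset.set_map)+
  then show ?thesis unfolding swap_meet_def by blast
qed

lemma swap_meet_diag_flip:
  assumes "swap_meet (diag_flip P) (image_mset prod.swap A) (image_mset prod.swap B)"
  shows "swap_meet P A B"
proof -
  obtain A' B' v where "swaps (diag_flip P) (image_mset prod.swap A) A'"
    "swaps (diag_flip P) (image_mset prod.swap B) B'" "v \<in># A'" "v \<in># B'"
    using assms by (auto simp: swap_meet_def)
  with swaps_map[of "diag_flip P" P prod.swap, OF swap_step_diag_flip[of "diag_flip P", simplified]]
  have "swaps P A (image_mset prod.swap A')" "swaps P B (image_mset prod.swap B')"
    "prod.swap v \<in># image_mset prod.swap A'" "prod.swap v \<in># image_mset prod.swap B'"
    by (force simp del: multiset.set_map)+
  then show ?thesis unfolding swap_meet_def by blast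
qed

text \<open>Reflection turns lower left quadrants into lower right ones. Such a quadrant is a lower
  half-plane minus a lower left quadrant, and half-plane counts agree because the row multisets
  do.\<close>

lemma balanced_xflip:
  assumes "balanced P A B"
  shows "balanced (xflip P) (image_mset xneg A) (image_mset xneg B)"
proof -
  have "size {#v \<in># image_mset xneg A. fst v \<le> x \<and> snd v \<le> y#}
      = size {#v \<in># image_mset xneg B. fst v \<le> x \<and> snd v \<le> y#}" if "(- x - 1, y) \<in> P" for x y
  proof -
    \<comment> \<open>Over the integers, \<open>- fst v \<le> x\<close> is the negation of
      \<open>fst v \<le> - x - 1\<close>.\<close>
    have *: "size {#v \<in># C. snd v \<le> y#} =
        size {#v \<in># image_mset xneg C. fst v \<le> x \<and> snd v \<le> y#} +
        size {#v \<in># C. fst v \<le> - x - 1 \<and> snd v \<le> y#}" for C :: "(int \<times> int) multiset"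
      by (induction C) auto
    have "size {#v \<in># A. fst v \<le> - x - 1 \<and> snd v \<le> y#} = size {#v \<in># B. fst v \<le> - x - 1 \<and> snd v \<le> y#}"
      by (rule balanced_quadrant[OF assms that])
    with balanced_size_snd[OF assms, of "\<lambda>t. t \<le> y"] *[of A] *[of B] show ?thesis by simp
  qed
  moreover have "image_mset fst (image_mset xneg C) = image_mset uminus (image_mset fst C)"
    "image_mset snd (image_mset xneg C) = image_mset snd C" for C :: "(int \<times> int) multiset"
    by (simp_all add: multiset.map_comp o_def)
  ultimately show ?thesis using assms unfolding balanced_def by (auto simp: xflip_def)
qed

lemma balanced_diag_flip:
  assumes "balanced P A B"
  shows "balanced (diag_flip P) (image_mset prod.swap A) (image_mset prod.swap B)"
proof -
  have "image_mset fst (image_mset prod.swap C) = image_mset snd C"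
    "image_mset snd (image_mset prod.swap C) = image_mset fst C"
    "size {#v \<in># image_mset prod.swap C. fst v \<le> y \<and> snd v \<le> x#}
      = size {#v \<in># C. fst v \<le> x \<and> snd v \<le> y#}" for C :: "(int \<times> int) multiset" and x y
    by (simp_all add: multiset.map_comp o_def filter_mset_image_mset conj_commute)
  with assms show ?thesis
    unfolding balanced_def diag_flip_def by (auto simp del: filter_mset_image_mset)
qed

lemma swap_meet_yflip:
  assumes "swap_meet (yflip P) (image_mset yneg A) (image_mset yneg B)"
  shows "swap_meet P A B"
  using swap_meet_diag_flip[OF swap_meet_xflip[OF swap_meet_diag_flip]] assms unfolding yflip_def image_yneg .

lemma balanced_yflip:
  assumes "balanced P A B"
  shows "balanced (yflip P) (image_mset yneg A) (image_mset yneg B)"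
  unfolding yflip_def image_yneg by (intro balanced_diag_flip balanced_xflip assms)

section \<open>Convex sets of cells\<close>

definition adjacent :: "int \<times> int \<Rightarrow> int \<times> int \<Rightarrow> bool" where
  "adjacent p q \<longleftrightarrow> \<bar>fst p - fst q\<bar> + \<bar>snd p - snd q\<bar> = 1"

text \<open>Connectedness is stated as the absence of proper nonempty subsets closed under adjacency.\<close>

locale convex_region =
  fixes P :: "(int \<times> int) set"
  assumes row_convex: "\<lbrakk>(x, y) \<in> P; (x', y) \<in> P; x \<le> t; t \<le> x'\<rbrakk> \<Longrightarrow> (t, y) \<in> P"
    and column_convex: "\<lbrakk>(x, y) \<in> P; (x, y') \<in> P; y \<le> t; t \<le> y'\<rbrakk> \<Longrightarrow> (x, t) \<in> P"
    and connected: "\<lbrakk>S \<noteq> {}; S \<subseteq> P; \<And>p q. \<lbrakk>p \<in> S; q \<in> P; adjacent p q\<rbrakk> \<Longrightarrow> q \<in> S\<rbrakk> \<Longrightarrow> S = P"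
begin

section \<open>Symmetries preserve convex regions\<close>

lemma convex_region_xflip: "convex_region (xflip P)"
proof
  fix S assume S: "S \<noteq> {}" "S \<subseteq> xflip P"
    "\<And>p q. \<lbrakk>p \<in> S; q \<in> xflip P; adjacent p q\<rbrakk> \<Longrightarrow> q \<in> S"
  have "xflip S = P"
  proof (rule connected)
    show "xflip S \<noteq> {}" using S(1) by simp
    show "xflip S \<subseteq> P" using S(2) by (force simp: xflip_def)
    fix p q assume pq: "p \<in> xflip S" "q \<in> P" "adjacent p q"
    obtain a b c d where [simp]: "p = (a, b)" "q = (c, d)" by fastforce
    have "(- c - 1, d) \<in> S"
      using S(3)[of "(- a - 1, b)" "(- c - 1, d)"] pq by (simp add: adjacent_def)
    then show "q \<in> xflip S" by simp
  qed
  then show "S = xflip P" by (metis xflip_xflip)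
next
  fix x y x' t assume "(x, y) \<in> xflip P" "(x', y) \<in> xflip P" "x \<le> t" "t \<le> x'"
  then show "(t, y) \<in> xflip P" using row_convex[of "- x' - 1" y "- x - 1" "- t - 1"] by simp
next
  fix x y y' t assume "(x, y) \<in> xflip P" "(x, y') \<in> xflip P" "y \<le> t" "t \<le> y'"
  then show "(x, t) \<in> xflip P" using column_convex[of "- x - 1" y y' t] by simp
qed

lemma convex_region_diag_flip: "convex_region (diag_flip P)"
proof
  fix S assume S: "S \<noteq> {}" "S \<subseteq> diag_flip P"
    "\<And>p q. \<lbrakk>p \<in> S; q \<in> diag_flip P; adjacent p q\<rbrakk> \<Longrightarrow> q \<in> S"
  have "diag_flip S = P"
  proof (rule connected)
    show "diag_flip S \<noteq> {}" using S(1) by simp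
    show "diag_flip S \<subseteq> P" using S(2) by (force simp: diag_flip_def)
    fix p q assume pq: "p \<in> diag_flip S" "q \<in> P" "adjacent p q"
    obtain a b c d where [simp]: "p = (a, b)" "q = (c, d)" by fastforce
    have "(d, c) \<in> S"
      using S(3)[of "(b, a)" "(d, c)"] pq by (simp add: adjacent_def)
    then show "q \<in> diag_flip S" by simp
  qed
  then show "S = diag_flip P" by (metis diag_flip_diag_flip)
next
  fix x y x' t assume "(x, y) \<in> diag_flip P" "(x', y) \<in> diag_flip P" "x \<le> t" "t \<le> x'"
  then show "(t, y) \<in> diag_flip P" using column_convex[of y x x' t] by simp
next
  fix x y y' t assume "(x, y) \<in> diag_flip P" "(x, y') \<in> diag_flip P" "y \<le> t" "t \<le> y'"
  then show "(x, t) \<in> diag_flip P" using row_convex[of y x y' t] by simp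
qed

section \<open>Crossing a grid line inside the region\<close>

text \<open>If \<open>P\<close> crossed the line below row \<open>j\<close> only on one side of the two given columns, the nearer
  of these columns would cut off one of the two cells.\<close>

lemma crossing:
  assumes p: "(x, y) \<in> P" and q: "(x', y') \<in> P" and "y < j" "j \<le> y'"
  shows "\<exists>t. min x x' \<le> t \<and> t \<le> max x x' \<and> (t, j - 1) \<in> P \<and> (t, j) \<in> P"
proof (rule ccontr)
  assume none: "\<not> ?thesis"
  \<comment> \<open>Column \<open>x\<close> lies entirely below the line and column
    \<open>x'\<close> entirely above it; by column convexity either would otherwise cross the line
    itself.\<close>
  have low: "t < j" if "(x, t) \<in> P" for t
  proof (rule ccontr)
    assume "\<not> t < j"
    with p that \<open>y < j\<close> have "(x, j - 1) \<in> P" "(x, j) \<in> P"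
      by (auto intro: column_convex[of x y t])
    with none show False by auto
  qed
  have high: "j \<le> t" if "(x', t) \<in> P" for t
  proof (rule ccontr)
    assume "\<not> j \<le> t"
    with q that \<open>j \<le> y'\<close> have "(x', j - 1) \<in> P" "(x', j) \<in> P"
      by (auto intro: column_convex[of x' t y'])
    with none show False by auto
  qed
  have xx: "x \<noteq> x'" using low[of y'] q \<open>j \<le> y'\<close> by auto
  have contra: False if S: "s \<in> S" "s \<in> P" "r \<in> P" "r \<notin> S"
    "\<And>a b c d. \<lbrakk>(a, b) \<in> S; (a, b) \<in> P; (c, d) \<in> P; adjacent (a, b) (c, d)\<rbrakk> \<Longrightarrow> (c, d) \<in> S" for S s r
    using connected[of "S \<inter> P"] S by (metis IntD1 IntD2 IntI empty_iff inf_le2 surj_pair)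
  define crosses where "crosses t \<longleftrightarrow> (t, j - 1) \<in> P \<and> (t, j) \<in> P" for t
  \<comment> \<open>Crossings on both sides of the two columns would, by row convexity just below
    and just above the line, force a crossing at \<open>x\<close>.\<close>
  have one_sided: "(\<forall>t. crosses t \<longrightarrow> t < min x x') \<or> (\<forall>t. crosses t \<longrightarrow> max x x' < t)"
  proof (rule ccontr)
    assume "\<not> ?thesis"
    then obtain s t where st: "crosses s" "crosses t" "min x x' \<le> s" "t \<le> max x x'" by force
    with none have "max x x' < s" "t < min x x'" by (auto simp: crosses_def)
    then have "crosses x"
      using st row_convex[of t _ s x] unfolding crosses_def by auto
    with none show False by (auto simp: crosses_def)
  qed
  have crossI: "crosses a" if "(a, b) \<in> P" "(c, d) \<in> P" "adjacent (a, b) (c, d)" "b < j" "j \<le> d" for a b c d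
  proof -
    from that have "c = a" "b = j - 1" "d = j" by (auto simp: adjacent_def)
    with that show ?thesis by (simp add: crosses_def)
  qed
  have crossI': "crosses a" if "(a, b) \<in> P" "(c, d) \<in> P" "adjacent (a, b) (c, d)" "d < j" "j \<le> b" for a b c d
  proof -
    from that have "c = a" "d = j - 1" "b = j" by (auto simp: adjacent_def)
    with that show ?thesis by (simp add: crosses_def)
  qed
  have adj: "\<bar>a - c\<bar> \<le> 1" if "adjacent (a, b) (c, d)" for a b c d
    using that by (simp add: adjacent_def)
  \<comment> \<open>In each case the chosen set is a quarter plane bounded by the line, uncrossed
    there, and by the column nearer to the crossings, which has no cell on that side of the line. So
    its part in \<open>P\<close> is closed under adjacency and separates the two cells.\<close>
  from one_sided xx consider
      "\<forall>t. crosses t \<longrightarrow> max x x' < t" "x < x'" | "\<forall>t. crosses t \<longrightarrow> max x x' < t" "x' < x"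
    | "\<forall>t. crosses t \<longrightarrow> t < min x x'" "x < x'" | "\<forall>t. crosses t \<longrightarrow> t < min x x'" "x' < x"
    by (metis linorder_neq_iff)
  then show False
  proof cases
    case 1
    show False
    proof (rule contra[of "(x, y)" "{(a, b). a \<le> x' \<and> b < j}" "(x', y')"])
      fix a b c d assume *: "(a, b) \<in> {(a, b). a \<le> x' \<and> b < j}" "(a, b) \<in> P" "(c, d) \<in> P" "adjacent (a, b) (c, d)"
      have "a \<noteq> x'" using * high by force
      moreover have "d < j" using crossI[OF *(2-4)] 1 * by force
      ultimately show "(c, d) \<in> {(a, b). a \<le> x' \<and> b < j}" using * adj[OF *(4)] by auto
    qed (use p q 1 assms in auto)
  next
    case 2
    show False
    proof (rule contra[of "(x', y')" "{(a, b). a \<le> x \<and> j \<le> b}" "(x, y)"])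
      fix a b c d assume *: "(a, b) \<in> {(a, b). a \<le> x \<and> j \<le> b}" "(a, b) \<in> P" "(c, d) \<in> P" "adjacent (a, b) (c, d)"
      have "a \<noteq> x" using * low by force
      moreover have "j \<le> d" using crossI'[OF *(2-4)] 2 * by force
      ultimately show "(c, d) \<in> {(a, b). a \<le> x \<and> j \<le> b}" using * adj[OF *(4)] by auto
    qed (use p q 2 assms in auto)
  next
    case 3
    show False
    proof (rule contra[of "(x', y')" "{(a, b). x \<le> a \<and> j \<le> b}" "(x, y)"])
      fix a b c d assume *: "(a, b) \<in> {(a, b). x \<le> a \<and> j \<le> b}" "(a, b) \<in> P" "(c, d) \<in> P" "adjacent (a, b) (c, d)"
      have "a \<noteq> x" using * low by force
      moreover have "j \<le> d" using crossI'[OF *(2-4)] 3 * by force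
      ultimately show "(c, d) \<in> {(a, b). x \<le> a \<and> j \<le> b}" using * adj[OF *(4)] by auto
    qed (use p q 3 assms in auto)
  next
    case 4
    show False
    proof (rule contra[of "(x, y)" "{(a, b). x' \<le> a \<and> b < j}" "(x', y')"])
      fix a b c d assume *: "(a, b) \<in> {(a, b). x' \<le> a \<and> b < j}" "(a, b) \<in> P" "(c, d) \<in> P" "adjacent (a, b) (c, d)"
      have "a \<noteq> x'" using * high by force
      moreover have "d < j" using crossI[OF *(2-4)] 4 * by force
      ultimately show "(c, d) \<in> {(a, b). x' \<le> a \<and> b < j}" using * adj[OF *(4)] by auto
    qed (use p q 4 assms in auto)
  qed
qed

text \<open>Unless the first cell is already in row \<open>t\<close>, the line below that row is
  crossed between the two columns. The lower bound on \<open>s\<close> later supplies a cell to the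
  right of a given column.\<close>

lemma row_hit:
  assumes "(x, y) \<in> P" "(x', y') \<in> P" "y \<le> t" "t \<le> y'"
  shows "\<exists>s \<ge> min x x'. (s, t) \<in> P"
proof (cases "y = t")
  case False
  with assms crossing[of x y x' y' t] show ?thesis by auto
qed (use assms in \<open>auto intro!: exI[of _ x]\<close>)

lemma crossing_col:
  assumes "(x, y) \<in> P" "(x', y') \<in> P" "x < i" "i \<le> x'"
  shows "\<exists>h. (i - 1, h) \<in> P \<and> (i, h) \<in> P"
  using convex_region.crossing[OF convex_region_diag_flip, of y x y' x' i] assms by auto

section \<open>Counts on the two sides of a cut\<close>

text \<open>The quadrants of the two neighbouring cells differ exactly by the points of column
  \<open>i\<close> at height at most \<open>h\<close>. Thus their common edge cuts the column, and
  each side of the cut is balanced separately.\<close>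

lemma balanced_seg_low:
  assumes bal: "balanced P A B" and "(i - 1, h) \<in> P" "(i, h) \<in> P"
  shows "size {#v \<in># A. fst v = i \<and> snd v \<le> h#} = size {#v \<in># B. fst v = i \<and> snd v \<le> h#}"
proof -
  have *: "size {#v \<in># C. fst v \<le> i \<and> snd v \<le> h#} =
      size {#v \<in># C. fst v \<le> i - 1 \<and> snd v \<le> h#} + size {#v \<in># C. fst v = i \<and> snd v \<le> h#}"
    for C :: "(int \<times> int) multiset"
    by (rule size_filter_split) auto
  show ?thesis
    using *[of A] *[of B] balanced_quadrant[OF bal assms(2)] balanced_quadrant[OF bal assms(3)] by simp
qed

lemma balanced_seg_high:
  assumes bal: "balanced P A B" and "(i - 1, h) \<in> P" "(i, h) \<in> P"
  shows "size {#v \<in># A. fst v = i \<and> h < snd v#} = size {#v \<in># B. fst v = i \<and> h < snd v#}"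
proof -
  have *: "size {#v \<in># C. fst v = i#} =
      size {#v \<in># C. fst v = i \<and> snd v \<le> h#} + size {#v \<in># C. fst v = i \<and> h < snd v#}"
    for C :: "(int \<times> int) multiset"
    by (rule size_filter_split) auto
  show ?thesis
    using *[of A] *[of B] balanced_seg_low[OF assms] balanced_size_fst[OF bal, of "\<lambda>t. t = i"] by simp
qed

lemma seg_low_ex:
  assumes "balanced P A B" "(i - 1, h) \<in> P" "(i, h) \<in> P" "(i, j) \<in># A" "j \<le> h"
  shows "\<exists>l \<le> h. (i, l) \<in># B"
proof -
  have "{#v \<in># A. fst v = i \<and> snd v \<le> h#} \<noteq> {#}"
    using assms(4,5) by (force simp: filter_mset_eq_conv)
  then have "{#v \<in># B. fst v = i \<and> snd v \<le> h#} \<noteq> {#}"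
    using balanced_seg_low[OF assms(1-3)] by (metis size_eq_0_iff_empty)
  then show ?thesis by (auto simp: filter_mset_eq_conv)
qed

lemma seg_high_ex:
  assumes "balanced P A B" "(i - 1, h) \<in> P" "(i, h) \<in> P" "(i, j) \<in># A" "h < j"
  shows "\<exists>l > h. (i, l) \<in># B"
proof -
  have "{#v \<in># A. fst v = i \<and> h < snd v#} \<noteq> {#}"
    using assms(4,5) by (force simp: filter_mset_eq_conv)
  then have "{#v \<in># B. fst v = i \<and> h < snd v#} \<noteq> {#}"
    using balanced_seg_high[OF assms(1-3)] by (metis size_eq_0_iff_empty)
  then show ?thesis by (auto simp: filter_mset_eq_conv)
qed

text \<open>Column \<open>i\<close> is cut both just above and just below \<open>(i, j)\<close>, so
  the difference of two segment counts is the multiplicity of that point.\<close>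

lemma interior_point:
  assumes "balanced P A B" "(i - 1, j - 1) \<in> P" "(i, j - 1) \<in> P" "(i - 1, j) \<in> P" "(i, j) \<in> P" "(i, j) \<in># A"
  shows "(i, j) \<in># B"
proof -
  have *: "size {#v \<in># C. fst v = i \<and> snd v \<le> j#} =
      size {#v \<in># C. fst v = i \<and> snd v \<le> j - 1#} + size {#v \<in># C. v = (i, j)#}"
    for C :: "(int \<times> int) multiset"
    by (rule size_filter_split) auto
  have "size {#v \<in># A. v = (i, j)#} = size {#v \<in># B. v = (i, j)#}"
    using *[of A] *[of B] balanced_seg_low[of A B i j] balanced_seg_low[of A B i "j - 1"] assms by simp
  moreover have "{#v \<in># A. v = (i, j)#} \<noteq> {#}"
    using assms(6) by (auto simp: filter_mset_eq_conv)
  ultimately have "{#v \<in># B. v = (i, j)#} \<noteq> {#}"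
    by (metis size_eq_0_iff_empty)
  then show ?thesis by (auto simp: filter_mset_eq_conv)
qed

section \<open>Meeting in a row cut by the region\<close>

text \<open>A cell obstructing the swap either shows that \<open>(i', j)\<close> is interior to \<open>P\<close>, or yields a larger
  \<open>h\<close>, whence the induction on \<open>j - h\<close>.\<close>

lemma swap_meet_left_above:
  assumes bal: "balanced P A B" and A: "(i, j) \<in># A" and B: "(i', j) \<in># B" and "i < i'" "i' \<le> c"
    and c: "(c, j - 1) \<in> P" "(c, j) \<in> P"
    and "(i' - 1, h) \<in> P" "(i', h) \<in> P" "h < j"
  shows "swap_meet P A B"
  using assms(8-)
proof (induction "nat (j - h)" arbitrary: h rule: less_induct)
  case less
  \<comment> \<open>The cut of column \<open>i'\<close> at \<open>h\<close> lies below
    \<open>(i', j)\<close>, so the segment above the cut also contains a variable of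
    \<open>A\<close>.\<close>
  obtain l where l: "(i', l) \<in># A" "h < l"
    using seg_high_ex[OF balanced_sym[OF bal] less.prems(1,2) B less.prems(3)] by blast
  show ?case
  proof (cases "rect_free P i j i' l")
    case True
    then show ?thesis using swap_meet_by_swap A l(1) B by blast
  next
    case False
    then obtain x y where p: "(x, y) \<in> P" "i \<le> x" "x < i'" "min j l \<le> y" "y < max j l"
      using \<open>i < i'\<close> by (auto simp: rect_free_def)
    show ?thesis
    proof (cases "j \<le> y")
      case True
      \<comment> \<open>The cells \<open>(i' - 1, h)\<close> and \<open>(x, y)\<close> lie below and
        above the line at \<open>j\<close>, so it is crossed left of \<open>i'\<close>. With the
        crossing at \<open>c\<close> on the other side, row convexity fills all four cells around
        \<open>(i', j)\<close>.\<close>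
      with crossing[OF less.prems(1) p(1), of j] less.prems p
      obtain q where "q < i'" "(q, j - 1) \<in> P" "(q, j) \<in> P" by force
      with c \<open>i' \<le> c\<close> have "(i' - 1, j - 1) \<in> P" "(i', j - 1) \<in> P" "(i' - 1, j) \<in> P" "(i', j) \<in> P"
        by (auto intro: row_convex[of q _ c])
      from interior_point[OF balanced_sym[OF bal] this B] B show ?thesis
        by (blast intro: swap_meet_common)
    next
      case False
      with p l have y: "h < y" "y < j" by auto
      \<comment> \<open>A cell of row \<open>y\<close> weakly right of \<open>i'\<close>, together
        with the obstruction on the left, moves the cut of column \<open>i'\<close> up from
        \<open>h\<close> to \<open>y\<close>.\<close>
      obtain r where "i' \<le> r" "(r, y) \<in> P"
        using row_hit[OF less.prems(2) c(1), of y] y \<open>i' \<le> c\<close> by auto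
      with p have "(i' - 1, y) \<in> P" "(i', y) \<in> P"
        by (auto intro: row_convex[of x _ r])
      with less.hyps[of y] y show ?thesis by auto
    qed
  qed
qed

text \<open>If \<open>P\<close> has no cell left of the line at \<open>i'\<close>, the swap
  rectangle is free. Otherwise \<open>P\<close> reaches both sides of that line and cuts it at some
  height, below or above \<open>j\<close>; the second case mirrors the first.\<close>

lemma swap_meet_left_ordered:
  assumes bal: "balanced P A B" and A: "(i, j) \<in># A" and B: "(i', j) \<in># B" and "i < i'" "i' \<le> c"
    and c: "(c, j - 1) \<in> P" "(c, j) \<in> P"
  shows "swap_meet P A B"
proof (cases "\<exists>p\<in>P. fst p < i'")
  case False
  obtain l where "(i', l) \<in># A" using balanced_col_ex[OF balanced_sym[OF bal] B] by blast
  moreover from False have "rect_free P i j i' l" using \<open>i < i'\<close> by (auto simp: rect_free_def)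
  ultimately show ?thesis using swap_meet_by_swap A B by blast
next
  case True
  then obtain h where h: "(i' - 1, h) \<in> P" "(i', h) \<in> P"
    using crossing_col[OF _ c(1) _ \<open>i' \<le> c\<close>] by force
  show ?thesis
  proof (cases "h < j")
    case True
    with swap_meet_left_above[OF assms h] show ?thesis .
  next
    case False
    have "convex_region (yflip P)"
      unfolding yflip_def
      by (intro convex_region.convex_region_diag_flip convex_region.convex_region_xflip convex_region_axioms)
    moreover have "(i, - j) \<in># image_mset yneg A" "(i', - j) \<in># image_mset yneg B"
      using A B by force+
    \<comment> \<open>The cut at height \<open>h\<close> becomes one at \<open>- h - 1\<close>,
      which is smaller than \<open>- j\<close> because \<open>j \<le> h\<close>.\<close>
    ultimately have "swap_meet (yflip P) (image_mset yneg A) (image_mset yneg B)"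
      using c h False \<open>i < i'\<close> \<open>i' \<le> c\<close>
      by (intro convex_region.swap_meet_left_above[OF _ balanced_yflip[OF bal],
        where i = i and i' = i' and j = "- j" and h = "- h - 1" and c = c]) auto
    then show ?thesis by (rule swap_meet_yflip)
  qed
qed

text \<open>The cut of row \<open>j\<close> at \<open>c\<close> is balanced on its left side, so
  \<open>B\<close> also has a variable there. The two sides are exchanged if necessary to put the
  smaller column first.\<close>

lemma swap_meet_left:
  assumes bal: "balanced P A B" and A: "(i, j) \<in># A" and "i \<le> c" and c: "(c, j - 1) \<in> P" "(c, j) \<in> P"
  shows "swap_meet P A B"
proof -
  interpret T: convex_region "diag_flip P" by (rule convex_region_diag_flip)
  obtain i' where B: "(i', j) \<in># B" and "i' \<le> c"
    using T.seg_low_ex[OF balanced_diag_flip[OF bal], of j c i] A c \<open>i \<le> c\<close> by force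
  consider "i = i'" | "i < i'" | "i' < i" by linarith
  then show ?thesis
  proof cases
    case 1
    with A B show ?thesis by (blast intro: swap_meet_common)
  next
    case 2
    show ?thesis by (rule swap_meet_left_ordered[OF bal A B 2 \<open>i' \<le> c\<close> c])
  next
    case 3
    show ?thesis
      by (rule swap_meet_sym, rule swap_meet_left_ordered[OF balanced_sym[OF bal] B A 3 \<open>i \<le> c\<close> c])
  qed
qed

lemma swap_meet_right:
  assumes bal: "balanced P A B" and A: "(i, j) \<in># A" and "c < i" and c: "(c, j - 1) \<in> P" "(c, j) \<in> P"
  shows "swap_meet P A B"
proof -
  interpret X: convex_region "xflip P" by (rule convex_region_xflip)
  have "(- i, j) \<in># image_mset xneg A" using A by force
  from X.swap_meet_left[OF balanced_xflip[OF bal] this, of "- c - 1"] c \<open>c < i\<close>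
  have "swap_meet (xflip P) (image_mset xneg A) (image_mset xneg B)" by simp
  then show ?thesis by (rule swap_meet_xflip)
qed

lemma swap_meet_mid_row:
  assumes "balanced P A B" "(i, j) \<in># A" "(c, j - 1) \<in> P" "(c, j) \<in> P"
  shows "swap_meet P A B"
  using swap_meet_left[OF assms(1,2) _ assms(3,4)] swap_meet_right[OF assms(1,2) _ assms(3,4)]
  by (cases "i \<le> c") auto

section \<open>Variables outside all cut rows and columns\<close>

text \<open>Otherwise \<open>P\<close> has cells on both sides of the grid line through
  \<open>v\<close>, hence crosses it, and \<open>swap_meet_mid_row\<close> makes the pair
  meet.\<close>

lemma off_row:
  assumes bal: "balanced P A B" and no: "\<not> swap_meet P A B" and v: "v \<in># A"
  shows "(\<forall>p\<in>P. snd v \<le> snd p) \<or> (\<forall>p\<in>P. snd p < snd v)"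
proof (rule ccontr)
  assume "\<not> ?thesis"
  then obtain p q where pq: "p \<in> P" "q \<in> P" "snd p < snd v" "snd v \<le> snd q" by force
  then obtain c where "(c, snd v - 1) \<in> P" "(c, snd v) \<in> P"
    using crossing[of "fst p" "snd p" "fst q" "snd q" "snd v"] by auto
  with swap_meet_mid_row[OF bal, of "fst v" "snd v"] v no show False by simp
qed

lemma off_col:
  assumes bal: "balanced P A B" and no: "\<not> swap_meet P A B" and v: "v \<in># A"
  shows "(\<forall>p\<in>P. fst v \<le> fst p) \<or> (\<forall>p\<in>P. fst p < fst v)"
proof -
  interpret T: convex_region "diag_flip P" by (rule convex_region_diag_flip)
  have "\<not> swap_meet (diag_flip P) (image_mset prod.swap A) (image_mset prod.swap B)"
    using no swap_meet_diag_flip[of P A B] by blast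
  with T.off_row[OF balanced_diag_flip[OF bal], of "prod.swap v"] v show ?thesis
    by (fastforce simp: diag_flip_def)
qed

text \<open>The quadrant count of any one cell yields a variable \<open>(k, l)\<close> of
  \<open>B\<close>, which the absence of a meet pushes into the same corner region. The common
  variable \<open>(k, j)\<close> then arises from a swap below \<open>P\<close> in \<open>B\<close>
  and a swap left of \<open>P\<close> in \<open>A\<close>.\<close>

lemma swap_meet_corner:
  assumes bal: "balanced P A B" and A: "(i, j) \<in># A" and "P \<noteq> {}"
    and le: "\<forall>p\<in>P. i \<le> fst p \<and> j \<le> snd p"
  shows "swap_meet P A B"
proof (rule ccontr)
  assume no: "\<not> swap_meet P A B"
  obtain x y where p: "(x, y) \<in> P" using \<open>P \<noteq> {}\<close> by force
  have "(i, j) \<in># {#v \<in># A. fst v \<le> x \<and> snd v \<le> y#}" using A le p by force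
  then have "{#v \<in># B. fst v \<le> x \<and> snd v \<le> y#} \<noteq> {#}"
    using balanced_quadrant[OF bal p] by (metis empty_not_add_mset multi_member_split size_eq_0_iff_empty)
  then obtain k l where B: "(k, l) \<in># B" and kl: "k \<le> x" "l \<le> y"
    by (auto simp: filter_mset_eq_conv)
  have no': "\<not> swap_meet P B A" using no swap_meet_sym[of P B A] by blast
  \<comment> \<open>The cell \<open>(x, y)\<close> refutes the alternative that
    \<open>(k, l)\<close> lies to the right of \<open>P\<close>.\<close>
  have k: "\<forall>p\<in>P. k \<le> fst p"
    using off_col[OF balanced_sym[OF bal] no' B]
  proof
    assume "\<forall>p\<in>P. fst p < fst (k, l)"
    from bspec[OF this p] kl(1) show ?thesis by simp
  qed simp
  have l: "\<forall>p\<in>P. l \<le> snd p"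
    using off_row[OF balanced_sym[OF bal] no' B]
  proof
    assume "\<forall>p\<in>P. snd p < snd (k, l)"
    from bspec[OF this p] kl(2) show ?thesis by simp
  qed simp
  obtain i' where i': "(i', j) \<in># B" using balanced_row_ex[OF bal A] by blast
  have "rect_free P i' j k l" using le l unfolding rect_free_def by force
  then obtain B' where B': "swaps P B B'" "(k, j) \<in># B'"
    using swap_ex[OF i' B] by blast
  obtain l' where l': "(k, l') \<in># A" using balanced_col_ex[OF balanced_sym[OF bal] B] by blast
  have "rect_free P i j k l'" using le k unfolding rect_free_def by force
  then have "swap_meet P A B'" using swap_meet_by_swap A l' B'(2) by blast
  with no B'(1) swap_meet_swaps[of P A A B B'] show False by blast
qed

lemma swap_meet_corner_left:
  assumes bal: "balanced P A B" and A: "(i, j) \<in># A" and "P \<noteq> {}"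
    and le: "\<forall>p\<in>P. i \<le> fst p"
  shows "swap_meet P A B"
proof (rule ccontr)
  assume no: "\<not> swap_meet P A B"
  from off_row[OF bal no A] show False
  proof
    assume "\<forall>p\<in>P. snd (i, j) \<le> snd p"
    with swap_meet_corner[OF bal A \<open>P \<noteq> {}\<close>] le no show False by simp
  next
    assume high: "\<forall>p\<in>P. snd p < snd (i, j)"
    have "convex_region (yflip P)"
      unfolding yflip_def
      by (intro convex_region.convex_region_diag_flip convex_region.convex_region_xflip convex_region_axioms)
    moreover have "(i, - j) \<in># image_mset yneg A" using A by force
    moreover have "\<forall>p\<in>yflip P. i \<le> fst p \<and> - j \<le> snd p"
      using le high by force
    ultimately have "swap_meet (yflip P) (image_mset yneg A) (image_mset yneg B)"
      using \<open>P \<noteq> {}\<close> by (intro convex_region.swap_meet_corner[OF _ balanced_yflip[OF bal]]) simp_all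
    then have "swap_meet P A B" by (rule swap_meet_yflip)
    with no show False ..
  qed
qed

section \<open>Connecting balanced monomials\<close>

text \<open>An empty \<open>P\<close> obstructs no swap. Otherwise \<open>off_col\<close> places the
  variable left or right of \<open>P\<close>, two cases exchanged by reflection.\<close>

lemma swap_meet_nonempty:
  assumes bal: "balanced P A B" and "A \<noteq> {#}"
  shows "swap_meet P A B"
proof -
  obtain i j where A: "(i, j) \<in># A" using \<open>A \<noteq> {#}\<close> by (metis multiset_nonemptyE surj_pair)
  show ?thesis
  proof (cases "P = {}")
    case True
    obtain k where B: "(k, j) \<in># B" using balanced_row_ex[OF bal A] by blast
    obtain l where "(k, l) \<in># A" using balanced_col_ex[OF balanced_sym[OF bal] B] by blast
    then show ?thesis using swap_meet_by_swap[OF A _ _ B, where P = P] True by (simp add: rect_free_def)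
  next
    case False
    show ?thesis
    proof (rule ccontr)
      assume no: "\<not> swap_meet P A B"
      from off_col[OF bal no A] show False
      proof
        assume "\<forall>p\<in>P. fst (i, j) \<le> fst p"
        with swap_meet_corner_left[OF bal A False] no show False by simp
      next
        assume right: "\<forall>p\<in>P. fst p < fst (i, j)"
        interpret X: convex_region "xflip P" by (rule convex_region_xflip)
        have "(- i, j) \<in># image_mset xneg A" using A by force
        moreover have "xflip P \<noteq> {}" using False by simp
        moreover have "\<forall>p\<in>xflip P. - i \<le> fst p" using right by (force simp: xflip_def)
        ultimately have "swap_meet (xflip P) (image_mset xneg A) (image_mset xneg B)"
          using X.swap_meet_corner_left[OF balanced_xflip[OF bal]] by blast
        with no swap_meet_xflip[of P A B] show False by blast
      qed
    qed
  qed
qed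

text \<open>Move both sides until they share a variable, cancel it, connect the rest by induction
  and put it back; the moves made on \<open>B\<close> are finally reversed.\<close>

theorem balanced_imp_swaps: "balanced P A B \<Longrightarrow> swaps P A B"
proof (induction "size A" arbitrary: A B rule: less_induct)
  case less
  show ?case
  proof (cases "A = {#}")
    case True
    with balanced_size[OF less.prems] show ?thesis by simp
  next
    case False
    obtain A' B' v where *: "swaps P A A'" "swaps P B B'" "v \<in># A'" "v \<in># B'"
      using swap_meet_nonempty[OF less.prems False] by (auto simp: swap_meet_def)
    then obtain A1 B1 where [simp]: "A' = add_mset v A1" "B' = add_mset v B1"
      by (metis mset_add)
    have "balanced P A' B'"
      by (meson *(1,2) less.prems balanced_sym balanced_trans swaps_balanced)
    then have "balanced P A1 B1" by (simp add: balanced_add_iff)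
    moreover have "size A1 < size A" using balanced_size[OF swaps_balanced[OF *(1)]] by simp
    ultimately have "swaps P A' B'" using less.hyps swaps_add by simp
    with *(1) swaps_sym[OF *(2)] show ?thesis by (meson rtranclp_trans)
  qed
qed

end

section \<open>Monomial maps\<close>

definition map_monomials :: "('a \<Rightarrow> 'b) \<Rightarrow> ('a \<Rightarrow>\<^sub>0 'k::comm_monoid_add) \<Rightarrow> ('b \<Rightarrow>\<^sub>0 'k)" where
  "map_monomials r f = (\<Sum>t\<in>Poly_Mapping.keys f. Poly_Mapping.single (r t) (Poly_Mapping.lookup f t))"

lemma map_monomials_zero [simp]: "map_monomials r 0 = 0"
  by (simp add: map_monomials_def)

lemma map_monomials_single [simp]: "map_monomials r (Poly_Mapping.single t c) = Poly_Mapping.single (r t) c"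
  by (cases "c = 0") (simp_all add: map_monomials_def)

lemma map_monomials_add: "map_monomials r (f + g) = map_monomials r f + map_monomials r g"
  unfolding map_monomials_def by (rule setsum_keys_plus_distrib) (simp_all add: single_add)

lemma map_monomials_sum: "map_monomials r (\<Sum>x\<in>A. f x) = (\<Sum>x\<in>A. map_monomials r (f x))"
  by (induction A rule: infinite_finite_induct) (simp_all add: map_monomials_add)

lemma map_monomials_diff: "map_monomials r (f - g) = map_monomials r f - map_monomials r g"
  for f g :: "'a \<Rightarrow>\<^sub>0 'k::ab_group_add"
  using map_monomials_add[of r "f - g" g] by (simp add: algebra_simps)

lemma map_monomials_comp: "map_monomials s (map_monomials r f) = map_monomials (\<lambda>t. s (r t)) f"
  by (simp add: map_monomials_def[of r] map_monomials_sum) (simp add: map_monomials_def)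

lemma sum_monomials:
  fixes f :: "'a \<Rightarrow>\<^sub>0 'k::comm_monoid_add"
  shows "(\<Sum>t\<in>Poly_Mapping.keys f. Poly_Mapping.single t (Poly_Mapping.lookup f t)) = f"
  by (rule poly_mapping_eqI)
    (auto simp: lookup_sum lookup_single when_def in_keys_iff cong: if_cong)

lemma poly_mapping_monomial_induct [case_names zero monomial_add]:
  fixes f :: "'a \<Rightarrow>\<^sub>0 'k::comm_monoid_add"
  assumes "Q 0" "\<And>t c f. Q f \<Longrightarrow> Q (Poly_Mapping.single t c + f)"
  shows "Q f"
proof -
  have "Q (\<Sum>t\<in>A. Poly_Mapping.single t (Poly_Mapping.lookup f t))" if "finite A" for A
    using that by induction (use assms in auto)
  then show ?thesis by (metis finite_keys sum_monomials)
qed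

text \<open>Both sides are biadditive, so two inductions reduce the claim to single terms, where it
  is the additivity of \<open>r\<close>.\<close>

lemma map_monomials_mult:
  fixes f g :: "'a::comm_monoid_add \<Rightarrow>\<^sub>0 'k::comm_semiring_0"
    and r :: "'a \<Rightarrow> 'b::comm_monoid_add"
  assumes r: "\<And>s t. r (s + t) = r s + r t"
  shows "map_monomials r (f * g) = map_monomials r f * map_monomials r g"
proof -
  have single: "map_monomials r (Poly_Mapping.single s c * g) = Poly_Mapping.single (r s) c * map_monomials r g" for s c
    by (induction g rule: poly_mapping_monomial_induct)
      (simp_all add: distrib_left map_monomials_add mult_single r)
  show ?thesis
    by (induction f rule: poly_mapping_monomial_induct) (simp_all add: distrib_right map_monomials_add single)
qed

section \<open>Monomials as multisets of variables\<close>

definition exponent :: "'v multiset \<Rightarrow> ('v \<Rightarrow>\<^sub>0 nat)" where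
  "exponent A = (\<Sum>v\<in>#A. Poly_Mapping.single v 1)"

definition mset_of :: "('v \<Rightarrow>\<^sub>0 nat) \<Rightarrow> 'v multiset" where
  "mset_of t = Abs_multiset (Poly_Mapping.lookup t)"

lemma lookup_exponent [simp]: "Poly_Mapping.lookup (exponent A) = count A"
  by (induction A) (auto simp: exponent_def lookup_add lookup_single when_def fun_eq_iff)

lemma count_mset_of [simp]: "count (mset_of t) = Poly_Mapping.lookup t"
  using finite_keys[of t] by (simp add: mset_of_def keys.rep_eq)

lemma exponent_mset_of [simp]: "exponent (mset_of t) = t"
  by (rule poly_mapping_eqI) simp

lemma mset_of_exponent [simp]: "mset_of (exponent A) = A"
  by (rule multiset_eqI) simp

lemma mset_of_add [simp]: "mset_of (s + t) = mset_of s + mset_of t"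
  by (rule multiset_eqI) (simp add: lookup_add)

lemma mset_of_zero [simp]: "mset_of 0 = {#}"
  by (rule multiset_eqI) simp

lemma mset_of_single [simp]: "mset_of (Poly_Mapping.single v (Suc 0)) = {#v#}"
  by (rule multiset_eqI) (simp add: lookup_single when_def)

lemma set_mset_of [simp]: "set_mset (mset_of t) = Poly_Mapping.keys t"
  by (auto simp: set_mset_def keys.rep_eq)

lemma keys_exponent [simp]: "Poly_Mapping.keys (exponent A) = set_mset A"
  by (metis mset_of_exponent set_mset_of)

lemma exponent_add_mset: "exponent (add_mset v A) = Poly_Mapping.single v 1 + exponent A"
  by (simp add: exponent_def)

section \<open>Convex polyominoes as regions\<close>

definition int_point :: "point \<Rightarrow> int \<times> int" where
  "int_point = map_prod int int"

lemma int_point_Pair [simp]: "int_point (i, j) = (int i, int j)"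
  by (simp add: int_point_def)

lemma fst_int_point [simp]: "fst (int_point v) = int (fst v)"
  and snd_int_point [simp]: "snd (int_point v) = int (snd v)"
  by (simp_all add: int_point_def)

definition corners :: "cell set \<Rightarrow> point set" where
  "corners P = {p. cell_at p \<in> P}"

lemma finite_corners: "finite P \<Longrightarrow> finite (corners P)"
  unfolding corners_def by (rule finite_vimageI[unfolded vimage_def]) (auto intro: injI)

lemma mem_cell_at: "(x, y) \<in> cell_at (i, j) \<longleftrightarrow> (x = i \<or> x = Suc i) \<and> (y = j \<or> y = Suc j)"
  by (auto simp: cell_at_eq)

text \<open>The two ends of the common edge leave only \<open>p\<close> itself and one neighbour as
  candidates for \<open>q\<close>; a third vertex of \<open>p\<close> missing from the intersection
  rules out \<open>p\<close>.\<close>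

lemma edge_imp_adjacent:
  assumes "is_edge_of (cell_at p \<inter> cell_at q) (cell_at p)"
  shows "adjacent (int_point p) (int_point q)"
proof -
  obtain a b c d where [simp]: "p = (a, b)" "q = (c, d)" by fastforce
  let ?E = "cell_at p \<inter> cell_at q"
  consider "?E = {(a, b), (Suc a, b)}" | "?E = {(a, b), (a, Suc b)}"
    | "?E = {(Suc a, b), (Suc a, Suc b)}" | "?E = {(a, Suc b), (Suc a, Suc b)}"
    using assms by (auto simp: is_edge_of_def)
  then show ?thesis
  proof cases
    case 1
    then have "v \<in> ?E \<longleftrightarrow> v = (a, b) \<or> v = (Suc a, b)" for v by simp
    from this[of "(a, b)"] this[of "(Suc a, b)"] this[of "(a, Suc b)"]
    show ?thesis by (auto simp: mem_cell_at adjacent_def)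
  next
    case 2
    then have "v \<in> ?E \<longleftrightarrow> v = (a, b) \<or> v = (a, Suc b)" for v by simp
    from this[of "(a, b)"] this[of "(a, Suc b)"] this[of "(Suc a, b)"]
    show ?thesis by (auto simp: mem_cell_at adjacent_def)
  next
    case 3
    then have "v \<in> ?E \<longleftrightarrow> v = (Suc a, b) \<or> v = (Suc a, Suc b)" for v by simp
    from this[of "(Suc a, b)"] this[of "(Suc a, Suc b)"] this[of "(a, b)"]
    show ?thesis by (auto simp: mem_cell_at adjacent_def)
  next
    case 4
    then have "v \<in> ?E \<longleftrightarrow> v = (a, Suc b) \<or> v = (Suc a, Suc b)" for v by simp
    from this[of "(a, Suc b)"] this[of "(Suc a, Suc b)"] this[of "(a, b)"]
    show ?thesis by (auto simp: mem_cell_at adjacent_def)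
  qed
qed

lemma mem_int_corners [simp]: "(int i, int j) \<in> int_point ` corners P \<longleftrightarrow> cell_at (i, j) \<in> P"
  by (force simp: corners_def)

lemma convex_polyomino_region:
  assumes poly: "polyomino P" and conv: "convex_cells P"
  shows "convex_region (int_point ` corners P)"
proof
  fix x y x' t assume *: "(x, y) \<in> int_point ` corners P" "(x', y) \<in> int_point ` corners P" "x \<le> t" "t \<le> x'"
  then obtain i j k where ijk: "x = int i" "y = int j" "x' = int k" by (auto simp: int_point_def)
  obtain r where r: "t = int r" using *(3) ijk(1) by (metis nonneg_int_cases of_nat_0_le_iff order_trans)
  have "cell_at (i, j) \<in> P" "cell_at (k, j) \<in> P" "i \<le> r" "r \<le> k" using * by (simp_all add: ijk r)
  then have "cell_at (r, j) \<in> P"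
    using conv unfolding convex_cells_def row_convex_def by (meson order_trans)
  then show "(t, y) \<in> int_point ` corners P" by (simp add: ijk r)
next
  fix x y y' t assume *: "(x, y) \<in> int_point ` corners P" "(x, y') \<in> int_point ` corners P" "y \<le> t" "t \<le> y'"
  then obtain i j k where ijk: "x = int i" "y = int j" "y' = int k" by (auto simp: int_point_def)
  obtain r where r: "t = int r" using *(3) ijk(2) by (metis nonneg_int_cases of_nat_0_le_iff order_trans)
  have "cell_at (i, j) \<in> P" "cell_at (i, k) \<in> P" "j \<le> r" "r \<le> k" using * by (simp_all add: ijk r)
  then have "cell_at (i, r) \<in> P"
    using conv unfolding convex_cells_def column_convex_def by (meson order_trans)
  then show "(x, t) \<in> int_point ` corners P" by (simp add: ijk r)
next
  fix S assume S: "S \<noteq> {}" "S \<subseteq> int_point ` corners P"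
    "\<And>p q. \<lbrakk>p \<in> S; q \<in> int_point ` corners P; adjacent p q\<rbrakk> \<Longrightarrow> q \<in> S"
  obtain x where "x \<in> S" using S(1) by blast
  moreover from this S(2) obtain p where "x = int_point p" "cell_at p \<in> P"
    by (auto simp: corners_def)
  ultimately have p: "int_point p \<in> S" "cell_at p \<in> P" by simp_all
  have "int_point q \<in> S" if q: "cell_at q \<in> P" for q
  proof -
    have "connected_cells P (cell_at p) (cell_at q)"
      using poly p(2) q by (simp add: polyomino_def)
    then obtain Cs where Cs: "Cs \<noteq> []" "set Cs \<subseteq> P" "hd Cs = cell_at p" "last Cs = cell_at q"
      "\<And>i. Suc i < length Cs \<Longrightarrow> is_edge_of (Cs ! i \<inter> Cs ! Suc i) (Cs ! i)"
      unfolding connected_cells_def by (elim exE conjE) simp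
    \<comment> \<open>Closure under adjacency carries membership in \<open>S\<close> along the
      path.\<close>
    have "\<exists>r. Cs ! i = cell_at r \<and> int_point r \<in> S" if "i < length Cs" for i
      using that
    proof (induction i)
      case 0
      with Cs p show ?case by (metis hd_conv_nth)
    next
      case (Suc i)
      then obtain r where r: "Cs ! i = cell_at r" "int_point r \<in> S" by auto
      have "Cs ! Suc i \<in> P" using Suc.prems Cs(2) nth_mem by blast
      moreover from this obtain s where s: "Cs ! Suc i = cell_at s"
        using poly by (auto simp: polyomino_def)
      ultimately have "int_point s \<in> int_point ` corners P" by (simp add: corners_def)
      moreover have "adjacent (int_point r) (int_point s)"
        using Cs(5)[OF Suc.prems] edge_imp_adjacent by (simp add: r s)
      ultimately show ?case using S(3) r s by blast
    qed
    from this[of "length Cs - 1"] Cs(1,4) show ?thesis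
      by (auto simp: last_conv_nth)
  qed
  then have "int_point ` corners P \<subseteq> S" by (auto simp: corners_def)
  with S(2) show "S = int_point ` corners P" by blast
qed

lemma interval_corners:
  assumes "interval_of Q (i, j) (k, l)"
  shows "(i, j) \<in> cell_vertices Q" "(k, l) \<in> cell_vertices Q"
    "(i, l) \<in> cell_vertices Q" "(k, j) \<in> cell_vertices Q"
proof -
  have lt: "i < k" "j < l" using assms by (simp_all add: interval_of_def strictly_below_def)
  have Q: "v \<in> cell_vertices Q" if "v \<in> cell_at (x, y)" "i \<le> x" "x < k" "j \<le> y" "y < l" for v x y
  proof -
    have "cell_at (x, y) \<in> cells_in {(i, j)..(k, l)}"
      using that(2-) by (simp add: cells_in_def) (auto simp: cell_at_eq)
    with assms that(1) show ?thesis by (auto simp: interval_of_def cell_vertices_def)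
  qed
  show "(i, j) \<in> cell_vertices Q" "(k, l) \<in> cell_vertices Q"
    "(i, l) \<in> cell_vertices Q" "(k, j) \<in> cell_vertices Q"
    using lt Q[of _ i j] Q[of _ "k - 1" "l - 1"] Q[of _ i "l - 1"] Q[of _ "k - 1" j]
    by (auto simp: mem_cell_at)
qed

section \<open>The toric map\<close>

text \<open>Variables of the target are encoded as natural numbers, because the library provides the
  integral domain instance only for linearly ordered exponents.\<close>

definition toric_weight :: "cell set \<Rightarrow> point \<Rightarrow> (nat \<Rightarrow>\<^sub>0 nat)" where
  "toric_weight P v =
     Poly_Mapping.single (to_nat (Inl (fst v) :: nat + nat + point)) 1 +
     Poly_Mapping.single (to_nat (Inr (Inl (snd v)) :: nat + nat + point)) 1 +
     (\<Sum>p\<in>corners P. Poly_Mapping.single (to_nat (Inr (Inr p) :: nat + nat + point)) (of_bool (v \<le> p)))"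

definition toric_exponent :: "cell set \<Rightarrow> (point \<Rightarrow>\<^sub>0 nat) \<Rightarrow> (nat \<Rightarrow>\<^sub>0 nat)" where
  "toric_exponent P t = (\<Sum>v\<in>#mset_of t. toric_weight P v)"

lemma toric_exponent_add: "toric_exponent P (s + t) = toric_exponent P s + toric_exponent P t"
  by (simp add: toric_exponent_def)

lemma toric_exponent_zero [simp]: "toric_exponent P 0 = 0"
  by (simp add: toric_exponent_def)

lemma lookup_sum_mset:
  "Poly_Mapping.lookup (\<Sum>v\<in>#A. f v) k = (\<Sum>v\<in>#A. Poly_Mapping.lookup (f v) k)"
  by (induction A) (simp_all add: lookup_add)

lemma lookup_toric_weight:
  assumes "finite P"
  shows "Poly_Mapping.lookup (toric_weight P v) (to_nat (Inl i :: nat + nat + point)) = of_bool (fst v = i)"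
    and "Poly_Mapping.lookup (toric_weight P v) (to_nat (Inr (Inl j) :: nat + nat + point)) = of_bool (snd v = j)"
    and "cell_at p \<in> P \<Longrightarrow>
      Poly_Mapping.lookup (toric_weight P v) (to_nat (Inr (Inr p) :: nat + nat + point)) = of_bool (v \<le> p)"
  using finite_corners[OF assms]
  by (simp_all add: toric_weight_def lookup_add lookup_sum lookup_single when_def corners_def sum.delta' cong: if_cong)

lemma sum_mset_of_bool: "(\<Sum>v\<in>#A. of_bool (Q v)) = size {#v \<in># A. Q v#}"
  by (induction A) auto

lemma count_image_mset_size: "count (image_mset f A) x = size {#v \<in># A. f v = x#}"
  by (induction A) auto

lemma toric_eq_imp_balanced:
  assumes "finite P" and eq: "toric_exponent P (exponent A) = toric_exponent P (exponent B)"
  shows "balanced (int_point ` corners P) (image_mset int_point A) (image_mset int_point B)"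
proof -
  have *: "(\<Sum>v\<in>#A. Poly_Mapping.lookup (toric_weight P v) k) = (\<Sum>v\<in>#B. Poly_Mapping.lookup (toric_weight P v) k)" for k
    using arg_cong[OF eq, of "\<lambda>f. Poly_Mapping.lookup f k"] by (simp add: toric_exponent_def lookup_sum_mset)
  have fst: "size {#v \<in># A. fst v = i#} = size {#v \<in># B. fst v = i#}" for i
    using *[of "to_nat (Inl i :: nat + nat + point)"] by (simp add: lookup_toric_weight[OF assms(1)] sum_mset_of_bool)
  have snd: "size {#v \<in># A. snd v = i#} = size {#v \<in># B. snd v = i#}" for i
    using *[of "to_nat (Inr (Inl i) :: nat + nat + point)"] by (simp add: lookup_toric_weight[OF assms(1)] sum_mset_of_bool)
  have le: "size {#v \<in># A. v \<le> p#} = size {#v \<in># B. v \<le> p#}" if "cell_at p \<in> P" for p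
    using *[of "to_nat (Inr (Inr p) :: nat + nat + point)"] that
    by (simp add: lookup_toric_weight[OF assms(1)] sum_mset_of_bool)
  have "image_mset fst A = image_mset fst B"
    by (rule multiset_eqI) (simp add: count_image_mset_size fst)
  moreover have "image_mset snd A = image_mset snd B"
    by (rule multiset_eqI) (simp add: count_image_mset_size snd)
  moreover have "image_mset fst (image_mset int_point C) = image_mset int (image_mset fst C)"
    "image_mset snd (image_mset int_point C) = image_mset int (image_mset snd C)" for C
    by (simp_all add: multiset.map_comp o_def)
  ultimately have "image_mset fst (image_mset int_point A) = image_mset fst (image_mset int_point B)"
    "image_mset snd (image_mset int_point A) = image_mset snd (image_mset int_point B)"
    by metis+
  with le show ?thesis
    by (auto simp: balanced_def corners_def filter_mset_image_mset less_eq_prod_def)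
qed

section \<open>The polyomino ideal as a kernel\<close>

lemma ideal_polyomino_ideal:
  "ideal (polyomino_ideal Q :: (point, 'k::comm_ring_1) polynomial set) (mpoly_ring (cell_vertices Q))"
  unfolding polyomino_ideal_def
  by (intro ring.genideal_ideal cring.axioms(1) cring_mpoly_ring inner_minors_in_carrier)

lemma polyomino_ideal_zero: "0 \<in> (polyomino_ideal Q :: (point, 'k::comm_ring_1) polynomial set)"
  using additive_subgroup.zero_closed[OF ideal.axioms(1)[OF ideal_polyomino_ideal[of Q]]]
  by (simp add: mpoly_ring_def)

lemma polyomino_ideal_add:
  fixes f g :: "(point, 'k::comm_ring_1) polynomial"
  assumes "f \<in> polyomino_ideal Q" "g \<in> polyomino_ideal Q"
  shows "f + g \<in> polyomino_ideal Q"
  using additive_subgroup.a_closed[OF ideal.axioms(1)[OF ideal_polyomino_ideal] assms]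
  by (simp add: mpoly_ring_def)

lemma polyomino_ideal_mult:
  fixes f g :: "(point, 'k::comm_ring_1) polynomial"
  assumes "f \<in> polyomino_ideal Q" "\<And>t. t \<in> Poly_Mapping.keys g \<Longrightarrow> Poly_Mapping.keys t \<subseteq> cell_vertices Q"
  shows "f * g \<in> polyomino_ideal Q"
proof -
  have "g \<in> carrier (mpoly_ring (cell_vertices Q))" using assms(2) by (simp add: mpoly_ring_def)
  from ideal.I_r_closed[OF ideal_polyomino_ideal assms(1) this] show ?thesis by (simp add: mpoly_ring_def)
qed

lemma polyomino_ideal_uminus:
  fixes f :: "(point, 'k::comm_ring_1) polynomial"
  assumes "f \<in> polyomino_ideal Q"
  shows "- f \<in> polyomino_ideal Q"
proof -
  have "f * - 1 \<in> polyomino_ideal Q" by (rule polyomino_ideal_mult[OF assms]) simp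
  then show ?thesis by simp
qed

lemma polyomino_ideal_sum:
  fixes f :: "'b \<Rightarrow> (point, 'k::comm_ring_1) polynomial"
  assumes "\<And>x. x \<in> A \<Longrightarrow> f x \<in> polyomino_ideal Q"
  shows "(\<Sum>x\<in>A. f x) \<in> polyomino_ideal Q"
  using assms by (induction A rule: infinite_finite_induct) (auto intro: polyomino_ideal_zero polyomino_ideal_add)

lemma polyomino_ideal_minor:
  "interval_of Q a b \<Longrightarrow> (inner_minor a b :: (point, 'k::comm_ring_1) polynomial) \<in> polyomino_ideal Q"
  unfolding polyomino_ideal_def
  by (rule subsetD[OF ring.genideal_self[OF cring.axioms(1)[OF cring_mpoly_ring] inner_minors_in_carrier]])
    (simp only: inner_minors_def mem_Collect_eq, blast)

section \<open>Swaps realised by inner minors\<close>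

lemma cell_vertices_subset: "cell_vertices (cells_in I - P) \<subseteq> I"
  by (auto simp: cell_vertices_def cells_in_def)

text \<open>Vertices of the complement lie in \<open>{a..b}\<close>, so the rectangle they span
  stays inside. Its cells could leave the complement only by belonging to \<open>P\<close>, which
  freeness forbids.\<close>

lemma swap_interval:
  assumes V: "(i, j) \<in> cell_vertices (cells_in {a..b} - P)" "(k, l) \<in> cell_vertices (cells_in {a..b} - P)"
    and free: "rect_free (int_point ` corners P) (int i) (int j) (int k) (int l)" and ne: "i \<noteq> k" "j \<noteq> l"
  shows "interval_of (cells_in {a..b} - P) (min i k, min j l) (max i k, max j l)"
proof -
  have in_ab: "a \<le> (i, j)" "(i, j) \<le> b" "a \<le> (k, l)" "(k, l) \<le> b"
    using V cell_vertices_subset by force+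
  have "cell_at (x, y) \<in> cells_in {a..b} - P" if sub: "cell_at (x, y) \<subseteq> {(min i k, min j l)..(max i k, max j l)}" for x y
  proof -
    have "(x, y) \<in> cell_at (x, y)" "(Suc x, Suc y) \<in> cell_at (x, y)" by (simp_all add: mem_cell_at)
    then have xy: "min i k \<le> x" "x < max i k" "min j l \<le> y" "y < max j l"
      using subsetD[OF sub] by fastforce+
    then have "cell_at (x, y) \<notin> P"
      using free by (force simp: rect_free_def corners_def)
    moreover have "cell_at (x, y) \<subseteq> {a..b}"
      using xy in_ab by (cases a; cases b) (auto simp: cell_at_eq min_def max_def split: if_splits)
    ultimately show ?thesis by (simp add: cells_in_def)
  qed
  then show ?thesis
    using ne by (auto simp: interval_of_def strictly_below_def cells_in_def)
qed

lemma swap_in_ideal: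
  assumes Q: "Q = cells_in {a..b} - P"
    and V: "(i, j) \<in> cell_vertices Q" "(k, l) \<in> cell_vertices Q"
    and free: "rect_free (int_point ` corners P) (int i) (int j) (int k) (int l)"
  shows "(i, l) \<in> cell_vertices Q" "(k, j) \<in> cell_vertices Q"
    "poly_var (i, j) * poly_var (k, l) - poly_var (i, l) * poly_var (k, j)
      \<in> (polyomino_ideal Q :: (point, 'k::comm_ring_1) polynomial set)"
proof -
  let ?f = "poly_var (i, j) * poly_var (k, l) - poly_var (i, l) * poly_var (k, j) :: (point, 'k) polynomial"
  have "(i, l) \<in> cell_vertices Q \<and> (k, j) \<in> cell_vertices Q \<and> ?f \<in> polyomino_ideal Q"
  proof (cases "i = k \<or> j = l")
    case True
    then have "?f = 0" by (auto simp: mult.commute)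
    with True V polyomino_ideal_zero show ?thesis by auto
  next
    case False
    then have int: "interval_of Q (min i k, min j l) (max i k, max j l)"
      using swap_interval[OF V[unfolded Q] free] by (simp add: Q)
    let ?g = "inner_minor (min i k, min j l) (max i k, max j l) :: (point, 'k) polynomial"
    \<comment> \<open>The sign depends on whether \<open>(i, j)\<close> and \<open>(k, l)\<close>
      are the diagonal or the anti-diagonal corners.\<close>
    have "?f = ?g \<or> ?f = - ?g"
      using False by (auto simp: inner_minor_def min_def max_def mult.commute)
    with polyomino_ideal_minor[OF int] polyomino_ideal_uminus[OF polyomino_ideal_minor[OF int]]
    have "?f \<in> polyomino_ideal Q" by metis
    moreover have "(i, l) \<in> cell_vertices Q" "(k, j) \<in> cell_vertices Q"
      using interval_corners[OF int] False by (auto simp: min_def max_def split: if_splits)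
    ultimately show ?thesis by blast
  qed
  then show "(i, l) \<in> cell_vertices Q" "(k, j) \<in> cell_vertices Q" "?f \<in> polyomino_ideal Q"
    by blast+
qed

definition monomial :: "point multiset \<Rightarrow> (point, 'k::comm_ring_1) polynomial" where
  "monomial A = Poly_Mapping.single (exponent A) 1"

lemma monomial_add_mset: "monomial (add_mset v A) = poly_var v * monomial A"
  by (simp add: monomial_def poly_var_def mult_single exponent_add_mset)

text \<open>The swapped points reuse the old coordinates, so they again come from natural numbers.
  The difference of the monomials is the binomial of the rectangle times the untouched part
  \<open>M\<close>.\<close>

lemma swap_step_in_ideal:
  assumes step: "swap_step (int_point ` corners P) (image_mset int_point A) B'"
    and V: "set_mset A \<subseteq> cell_vertices (cells_in {a..b} - P)"
  shows "\<exists>B. B' = image_mset int_point B \<and> set_mset B \<subseteq> cell_vertices (cells_in {a..b} - P) \<and>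
    monomial A - monomial B \<in> (polyomino_ideal (cells_in {a..b} - P) :: (point, 'k::comm_ring_1) polynomial set)"
proof -
  let ?Q = "cells_in {a..b} - P"
  obtain i' j' k' l' M' where A: "image_mset int_point A = add_mset (i', j') (add_mset (k', l') M')"
    and B': "B' = {#(i', l'), (k', j')#} + M'" and free: "rect_free (int_point ` corners P) i' j' k' l'"
    using step by (auto simp: swap_step_def)
  obtain v w M where A: "A = add_mset v (add_mset w M)"
    and vw: "int_point v = (i', j')" "int_point w = (k', l')" "image_mset int_point M = M'"
    using msed_map_invR[OF A] msed_map_invR by metis
  obtain i j k l where [simp]: "v = (i, j)" "w = (k, l)" by fastforce
  have [simp]: "i' = int i" "j' = int j" "k' = int k" "l' = int l" using vw by auto
  have free': "rect_free (int_point ` corners P) (int i) (int j) (int k) (int l)" using free by simp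
  have vwV: "(i, j) \<in> cell_vertices ?Q" "(k, l) \<in> cell_vertices ?Q" "set_mset M \<subseteq> cell_vertices ?Q"
    using V A by auto
  note swap = swap_in_ideal[OF refl vwV(1,2) free']
  define B where "B = add_mset (i, l) (add_mset (k, j) M)"
  have "monomial A - monomial B = (poly_var (i, j) * poly_var (k, l) - poly_var (i, l) * poly_var (k, j)) * (monomial M :: (point, 'k) polynomial)"
    by (simp add: A B_def monomial_add_mset left_diff_distrib mult.assoc)
  also have "\<dots> \<in> polyomino_ideal ?Q"
    by (rule polyomino_ideal_mult[OF swap(3)]) (use vwV(3) in \<open>simp add: monomial_def\<close>)
  finally have "monomial A - monomial B \<in> (polyomino_ideal ?Q :: (point, 'k) polynomial set)" .
  moreover have "B' = image_mset int_point B" using B' vw(3) by (simp add: B_def)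
  moreover have "set_mset B \<subseteq> cell_vertices ?Q" using swap(1,2) vwV(3) by (simp add: B_def)
  ultimately show ?thesis by blast
qed

text \<open>Differences along the chain telescope; keeping every intermediate multiset supported on
  vertices makes the next step applicable.\<close>

lemma swaps_in_ideal:
  assumes "swaps (int_point ` corners P) (image_mset int_point A) B'"
    and V: "set_mset A \<subseteq> cell_vertices (cells_in {a..b} - P)"
  shows "\<exists>B. B' = image_mset int_point B \<and> set_mset B \<subseteq> cell_vertices (cells_in {a..b} - P) \<and>
    monomial A - monomial B \<in> (polyomino_ideal (cells_in {a..b} - P) :: (point, 'k::comm_ring_1) polynomial set)"
  using assms(1)
proof induction
  case base
  have "monomial A - monomial A \<in> (polyomino_ideal (cells_in {a..b} - P) :: (point, 'k) polynomial set)"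
    by (simp add: polyomino_ideal_zero)
  with V show ?case by blast
next
  case (step B' C')
  then obtain B where B: "B' = image_mset int_point B" "set_mset B \<subseteq> cell_vertices (cells_in {a..b} - P)"
    "monomial A - monomial B \<in> (polyomino_ideal (cells_in {a..b} - P) :: (point, 'k) polynomial set)"
    by blast
  with swap_step_in_ideal[of P B C' a b, where 'k = 'k] step.hyps(2)
  obtain C where C: "C' = image_mset int_point C" "set_mset C \<subseteq> cell_vertices (cells_in {a..b} - P)"
    "monomial B - monomial C \<in> (polyomino_ideal (cells_in {a..b} - P) :: (point, 'k) polynomial set)"
    by blast
  have "monomial A - monomial C \<in> (polyomino_ideal (cells_in {a..b} - P) :: (point, 'k) polynomial set)"
    using polyomino_ideal_add[OF B(3) C(3)] by simp
  with C show ?case by blast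
qed

lemma inj_int_point: "inj int_point"
  by (auto intro!: injI simp: int_point_def)

lemma toric_eq_in_ideal:
  assumes P: "polyomino P" "convex_cells P"
    and eq: "toric_exponent P s = toric_exponent P t"
    and s: "Poly_Mapping.keys s \<subseteq> cell_vertices (cells_in {a..b} - P)"
  shows "Poly_Mapping.single s c - Poly_Mapping.single t c
    \<in> (polyomino_ideal (cells_in {a..b} - P) :: (point, 'k::comm_ring_1) polynomial set)"
proof -
  interpret convex_region "int_point ` corners P" by (rule convex_polyomino_region[OF P])
  have "finite P" using P by (simp add: polyomino_def)
  then have "balanced (int_point ` corners P) (image_mset int_point (mset_of s)) (image_mset int_point (mset_of t))"
    using eq by (intro toric_eq_imp_balanced) simp_all
  then have "swaps (int_point ` corners P) (image_mset int_point (mset_of s)) (image_mset int_point (mset_of t))"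
    by (rule balanced_imp_swaps)
  then obtain B where "image_mset int_point (mset_of t) = image_mset int_point B"
    "monomial (mset_of s) - monomial B \<in> (polyomino_ideal (cells_in {a..b} - P) :: (point, 'k) polynomial set)"
    using swaps_in_ideal[of P "mset_of s" _ a b, where 'k = 'k] s unfolding set_mset_of by blast
  then have "monomial (mset_of s) - monomial (mset_of t) \<in> (polyomino_ideal (cells_in {a..b} - P) :: (point, 'k) polynomial set)"
    using injD[OF multiset.inj_map[OF inj_int_point]] by blast
  \<comment> \<open>Multiplication by the constant \<open>c\<close> passes from monomials to
    terms.\<close>
  then have "(monomial (mset_of s) - monomial (mset_of t)) * Poly_Mapping.single 0 c
      \<in> (polyomino_ideal (cells_in {a..b} - P) :: (point, 'k) polynomial set)"
    by (rule polyomino_ideal_mult) (simp split: if_splits)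
  then show ?thesis by (simp add: monomial_def left_diff_distrib mult_single)
qed

section \<open>Comparison of ideal and kernel\<close>

text \<open>Row and column variables match directly. A cell variable could be unbalanced only for a
  cell inside the interval, and the interval avoids \<open>P\<close>.\<close>

lemma toric_weight_minor:
  assumes "strictly_below (i, j) (k, l)" "cells_in {(i, j)..(k, l)} \<inter> P = {}"
  shows "toric_weight P (i, j) + toric_weight P (k, l) = toric_weight P (i, l) + toric_weight P (k, j)"
proof -
  have lt: "i < k" "j < l" using assms(1) by (simp_all add: strictly_below_def)
  have "of_bool ((i, j) \<le> p) + of_bool ((k, l) \<le> p) = (of_bool ((i, l) \<le> p) + of_bool ((k, j) \<le> p) :: nat)"
    if "p \<in> corners P" for p
  proof -
    obtain x y where [simp]: "p = (x, y)" by fastforce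
    have "\<not> (i \<le> x \<and> x < k \<and> j \<le> y \<and> y < l)"
    proof
      assume "i \<le> x \<and> x < k \<and> j \<le> y \<and> y < l"
      then have "cell_at p \<in> cells_in {(i, j)..(k, l)}"
        by (simp add: cells_in_def) (auto simp: cell_at_eq)
      with that assms(2) show False by (auto simp: corners_def)
    qed
    with lt show ?thesis by auto
  qed
  then show ?thesis
    by (simp add: toric_weight_def algebra_simps sum.distrib[symmetric] single_add[symmetric] cong: sum.cong)
qed

lemma map_monomials_toric_minor:
  assumes "interval_of (cells_in {a..b} - P) u v"
  shows "map_monomials (toric_exponent P) (inner_minor u v :: (point, 'k::comm_ring_1) polynomial) = 0"
proof -
  obtain i j k l where [simp]: "u = (i, j)" "v = (k, l)" by fastforce
  have "toric_weight P (i, j) + toric_weight P (k, l) = toric_weight P (i, l) + toric_weight P (k, j)"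
    using assms by (intro toric_weight_minor) (auto simp: interval_of_def)
  then show ?thesis
    by (simp add: inner_minor_def poly_var_def mult_single map_monomials_diff toric_exponent_def add.commute)
qed

text \<open>The kernel is an ideal containing all inner minors. Conversely, a kernel element is a
  sum of differences of terms with equal toric image, each in the ideal by
  \<open>toric_eq_in_ideal\<close>.\<close>

lemma polyomino_ideal_eq_kernel:
  assumes P: "polyomino P" "convex_cells P"
  shows "polyomino_ideal (cells_in {a..b} - P) =
    {f \<in> carrier (mpoly_ring (cell_vertices (cells_in {a..b} - P))).
      map_monomials (toric_exponent P) f = (0 :: (nat \<Rightarrow>\<^sub>0 nat) \<Rightarrow>\<^sub>0 'k::comm_ring_1)}"
proof
  let ?V = "cell_vertices (cells_in {a..b} - P)"
  let ?R = "mpoly_ring ?V :: (point, 'k) polynomial ring"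
  let ?I = "polyomino_ideal (cells_in {a..b} - P) :: (point, 'k) polynomial set"
  let ?K = "{f \<in> carrier ?R. map_monomials (toric_exponent P) f = 0}"
  interpret R: cring ?R by (rule cring_mpoly_ring)
  have "additive_subgroup ?K ?R"
  proof
    fix f assume f: "f \<in> ?K"
    then have "- f \<in> carrier ?R" "f \<oplus>\<^bsub>?R\<^esub> - f = \<zero>\<^bsub>?R\<^esub>"
      by (simp_all add: mpoly_ring_def)
    then have "\<ominus>\<^bsub>?R\<^esub> f = - f"
      using f R.minus_equality[of "- f" f] by (simp add: R.add.m_comm)
    then have "inv\<^bsub>add_monoid ?R\<^esub> f = - f"
      by (simp add: a_inv_def)
    then show "inv\<^bsub>add_monoid ?R\<^esub> f \<in> ?K"
      using f \<open>- f \<in> carrier ?R\<close> map_monomials_diff[of "toric_exponent P" 0 f] by simp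
  qed (use R.add.m_closed in \<open>auto simp: mpoly_ring_def map_monomials_add\<close>)
  moreover have "f * g \<in> carrier ?R" if "f \<in> carrier ?R" "g \<in> carrier ?R" for f g
    using R.m_closed[OF that] by (simp add: mpoly_ring_def)
  moreover have [simp]: "f \<otimes>\<^bsub>?R\<^esub> g = f * g" for f g by (simp add: mpoly_ring_def)
  moreover have "map_monomials (toric_exponent P) (f * g) =
      map_monomials (toric_exponent P) f * map_monomials (toric_exponent P) g" for f g :: "(point, 'k) polynomial"
    by (rule map_monomials_mult[OF toric_exponent_add])
  ultimately have "ideal ?K ?R"
    by (intro idealI R.ring_axioms) (simp_all add: additive_subgroup_def)
  moreover have "inner_minors (cells_in {a..b} - P) \<subseteq> ?K"
  proof
    fix f :: "(point, 'k) polynomial" assume f: "f \<in> inner_minors (cells_in {a..b} - P)"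
    then have "f \<in> carrier ?R" using inner_minors_in_carrier by blast
    with f show "f \<in> ?K" by (auto simp: inner_minors_def map_monomials_toric_minor)
  qed
  ultimately show "?I \<subseteq> ?K"
    unfolding polyomino_ideal_def by (rule R.genideal_minimal)
  show "?K \<subseteq> ?I"
  proof
    fix f assume "f \<in> ?K"
    then have f: "\<And>t. t \<in> Poly_Mapping.keys f \<Longrightarrow> Poly_Mapping.keys t \<subseteq> ?V"
      and ker: "map_monomials (toric_exponent P) f = 0"
      by (simp_all add: mpoly_ring_def)
    \<comment> \<open>Modulo the ideal, \<open>f\<close> equals its image under the composition of the toric map with a
      section of it, which vanishes.\<close>
    define rep where "rep e = (SOME s. Poly_Mapping.keys s \<subseteq> ?V \<and> toric_exponent P s = e)" for e
    \<comment> \<open>The monomial \<open>t\<close> itself witnesses that the choice of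
      \<open>rep\<close> is possible.\<close>
    have rep: "toric_exponent P (rep (toric_exponent P t)) = toric_exponent P t" if "Poly_Mapping.keys t \<subseteq> ?V" for t
      using someI[of "\<lambda>s. Poly_Mapping.keys s \<subseteq> ?V \<and> toric_exponent P s = toric_exponent P t" t] that
      unfolding rep_def by blast
    have "map_monomials (\<lambda>t. rep (toric_exponent P t)) f = 0"
      using map_monomials_comp[of rep "toric_exponent P" f] ker by simp
    then have "f = f - map_monomials (\<lambda>t. rep (toric_exponent P t)) f" by simp
    also have "\<dots> = (\<Sum>t\<in>Poly_Mapping.keys f. Poly_Mapping.single t (Poly_Mapping.lookup f t) -
        Poly_Mapping.single (rep (toric_exponent P t)) (Poly_Mapping.lookup f t))"
      by (simp add: map_monomials_def sum_subtractf sum_monomials)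
    also have "\<dots> \<in> ?I"
      by (intro polyomino_ideal_sum toric_eq_in_ideal P) (use f rep in auto)
    finally show "f \<in> ?I" .
  qed
qed

section \<open>Primality of the kernel\<close>

theorem theorem2p1:
  fixes a b :: point and P :: "cell set"
  assumes "strictly_below a b"
    and "polyomino P" and "convex_cells P" and "P \<subseteq> cells_in {a..b}"
    and "polyomino (cells_in {a..b} - P)"
  shows "primeideal
           (polyomino_ideal (cells_in {a..b} - P) :: (point, 'k::field) polynomial set)
           (mpoly_ring (cell_vertices (cells_in {a..b} - P)))"
proof (rule primeidealI)
  let ?R = "mpoly_ring (cell_vertices (cells_in {a..b} - P)) :: (point, 'k) polynomial ring"
  let ?I = "polyomino_ideal (cells_in {a..b} - P) :: (point, 'k) polynomial set"
  note ker = polyomino_ideal_eq_kernel[OF assms(2,3), of a b, where 'k = 'k]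
  show "ideal ?I ?R" by (rule ideal_polyomino_ideal)
  show "cring ?R" by (rule cring_mpoly_ring)
  \<comment> \<open>Properness: \<open>1\<close> is the term with exponent \<open>0\<close>, so its
    image is \<open>1\<close> and it lies outside the kernel.\<close>
  have "map_monomials (toric_exponent P) (1 :: (point, 'k) polynomial) = 1"
    using map_monomials_single[of "toric_exponent P" 0 "1 :: 'k"] by simp
  then have "map_monomials (toric_exponent P) (1 :: (point, 'k) polynomial) \<noteq> 0" by simp
  moreover have "1 \<in> carrier ?R" by (simp add: mpoly_ring_def)
  ultimately show "carrier ?R \<noteq> ?I" unfolding ker by blast
  fix f g assume "f \<in> carrier ?R" "g \<in> carrier ?R" "f \<otimes>\<^bsub>?R\<^esub> g \<in> ?I"
  then have "map_monomials (toric_exponent P) f * map_monomials (toric_exponent P) g = 0"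
    unfolding ker by (simp add: mpoly_ring_def map_monomials_mult[OF toric_exponent_add])
  \<comment> \<open>The target polynomial ring over a field has no zero divisors, so one of the two
    images vanishes.\<close>
  then show "f \<in> ?I \<or> g \<in> ?I"
    using \<open>f \<in> carrier ?R\<close> \<open>g \<in> carrier ?R\<close> unfolding ker by simp
qed

end
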